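(* Let $\ell$ be a prime. The algorithm described in the context, run on input $\ell$, determines all temperaments $\tau$ with $\tau^2\in[\frac34\ell,\ell]$ that come from $3$-and-$1$ forms of index $\ell$: its output set $T$ is exactly the set of numbers $\tau^2\in[\frac34\ell,\ell]$ such that $\tau$ is the temperament of some $3$-and-$1$ form of index $\ell$.
   Context: Tempered perfect forms. A lattice in $\mathbb{R}^2\cong\mathbb{C}$ is the $\mathbb{Z}$-span of an $\mathbb{R}$-basis; $\langle\,,\rangle$ is the standard dot product. Let $\ell$ be a prime, $L$ a lattice and $M\subset L$ a sublattice of index $\ell$. The pair $(L,M)$ is a tempered perfect lattice (or form) of index $\ell$ if, after rescaling $L$ and $M$ by a common positive scalar, there exist non-empty sets $S\subset L-M$ and $S'\subset M-\{0\}$ such that, with $A(v)=\langle v,v\rangle$: (i) $A(v)=1$ for all $v\in S$; (ii) $A(v)>1$ for all $v\in L-M$ with $v\notin S$; (iii) $A(v)$ has a common value $u\geqslant 1$ for all $v\in S'$; (iv) $A(v)>u$ for all $v\in M-\{0\}$ with $v\notin S'$; (v) if $B$ is any positive definite quadratic form on $\mathbb{R}^2$ satisfying (i)--(iv) in place of $A$ with the same $S,S'$ and with common value $u'$ on $S'$, then $B=A$ and $u'=u$. The temperament is $\tau=\sqrt u$. It is called an $s$-and-$s'$ form if $S$ consists of $s$ pairs $\pm v$ and $S'$ consists of $s'$ pairs $\pm v$. The algorithm. Let $\omega=e^{2\pi i/3}$; the norm on $\mathbb{Z}[\omega]$ is $N(a+b\omega)=a^2-ab+b^2$ (the squared length),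 and $a+b\omega$ is primitive if $\gcd(a,b)=1$. The units of $\mathbb{Z}[\omega]$ are $\pm1,\pm\omega,\pm\omega^2$. Let $\beta_1=1<\beta_2=3<\beta_3=7<\cdots$ be the ordered list of integers that are norms of primitive elements of $\mathbb{Z}[\omega]$. Let $n$ be the last index (possibly none) with $\beta_n<\frac34\ell$ and $N$ the last index with $\beta_N<\ell$. Step 1. Let $\mathcal{L}=\{\beta_{n+1},\dots,\beta_N\}$. Make a table with one column for each norm in $\mathcal{L}$; under each norm list all primitive $v\in\mathbb{Z}[\omega]$ of that norm, up to multiplication by units (so each entry is a $\mathbb{Z}/6\mathbb{Z}$-orbit). Set $T=\emptyset$. Step 2. If $\mathcal{L}$ is empty, output $T$ and stop. Otherwise choose a (not crossed-out) $v$ under the smallest norm $\beta_{\alpha_0}$ in $\mathcal{L}$. Compute a second vector $\hat w$ as follows: write $v=a+b\omega$, take $c,d\in\mathbb{Z}$ with $ad-bc=1$, put $w=c+d\omega$, so that $v$ and $\ell w$ generate the unique index-$\ell$ sublattice $M$ of $\mathbb{Z}[\omega]$ containing $v$; let $z\in\mathbb{C}$ be perpendicular to $v$, on the same side of the line $\mathbb{R}v$ as $w$, with $|z|=\frac{\sqrt3\,\ell}{2|v|}$; then $t_0=(z-\ell w)/v\in\mathbb{R}$, $t$ is a nearest integer to $t_0$, and $\hat w=\ell w+tv$. Let $\beta_{\alpha_1}$ denote the norm of $\hat w$. Step 3. Add $\beta_{\alpha_0}$ to $T$. Step 4. Cross out the orbits of $v$ and $\hat w$ under the norms $\beta_{\alpha_0}$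 and $\beta_{\alpha_1}$ respectively; if the norm of $\hat w$ is not on the list, cross out only the orbit of $v$. If a column is then completely crossed out, delete its norm from $\mathcal{L}$. Go to Step 2. *)

theory Defs
  imports "HOL-Analysis.Analysis" "HOL-Computational_Algebra.Primes"
begin

section \<open>Tempered perfect forms\<close>

text \<open>The plane is \<^typ>\<open>complex\<close>, whose \<^const>\<open>inner\<close> is the standard dot product of \<open>R^2\<close>.\<close>

definition is_lattice :: "complex set \<Rightarrow> bool" where
  "is_lattice L \<longleftrightarrow>
     (\<exists>x y. x \<noteq> y \<and> independent {x, y} \<and> span {x, y} = UNIV \<and>
        L = {of_int m * x + of_int n * y | m n. True})"

definition is_sublattice_of_index :: "nat \<Rightarrow> complex set \<Rightarrow> complex set \<Rightarrow> bool" where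
  "is_sublattice_of_index l M L \<longleftrightarrow>
     is_lattice M \<and> M \<subseteq> L \<and>
     finite ((\<lambda>x. (+) x ` M) ` L) \<and> card ((\<lambda>x. (+) x ` M) ` L) = l"

definition pos_def_quadratic_form :: "(complex \<Rightarrow> real) \<Rightarrow> bool" where
  "pos_def_quadratic_form Q \<longleftrightarrow>
     (\<exists>b. bilinear b \<and> (\<forall>x y. b x y = b y x) \<and> (\<forall>x. Q x = b x x)) \<and>
     (\<forall>x. x \<noteq> 0 \<longrightarrow> Q x > 0)"

definition tempered_conditions ::
  "complex set \<Rightarrow> complex set \<Rightarrow> complex set \<Rightarrow> complex set \<Rightarrow> (complex \<Rightarrow> real) \<Rightarrow> real \<Rightarrow> bool" where
  "tempered_conditions L M S S' A u \<longleftrightarrow>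
     (\<forall>v\<in>S. A v = 1) \<and>
     (\<forall>v\<in>L - M. v \<notin> S \<longrightarrow> A v > 1) \<and>
     u \<ge> 1 \<and> (\<forall>v\<in>S'. A v = u) \<and>
     (\<forall>v\<in>M - {0}. v \<notin> S' \<longrightarrow> A v > u)"

definition normalized_tempered_perfect ::
  "complex set \<Rightarrow> complex set \<Rightarrow> complex set \<Rightarrow> complex set \<Rightarrow> real \<Rightarrow> bool" where
  "normalized_tempered_perfect L M S S' u \<longleftrightarrow>
     S \<noteq> {} \<and> S \<subseteq> L - M \<and> S' \<noteq> {} \<and> S' \<subseteq> M - {0} \<and>
     tempered_conditions L M S S' (\<lambda>v. inner v v) u \<and>
     (\<forall>B u'. pos_def_quadratic_form B \<and> tempered_conditions L M S S' B u' \<longrightarrow>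
        B = (\<lambda>v. inner v v) \<and> u' = u)"

text \<open>The witnesses of tempered perfection of \<open>(L, M)\<close>. The scaling factor, and with it
  \<open>S\<close>, \<open>S'\<close> and \<open>u\<close>, is unique when it exists: the least squared length on \<open>L - M\<close>
  must become 1.\<close>

definition tempered_perfect_data ::
  "nat \<Rightarrow> complex set \<Rightarrow> complex set \<Rightarrow> complex set \<Rightarrow> complex set \<Rightarrow> real \<Rightarrow> bool" where
  "tempered_perfect_data l L M S S' u \<longleftrightarrow>
     is_lattice L \<and> is_sublattice_of_index l M L \<and>
     (\<exists>c>0. normalized_tempered_perfect
        ((\<lambda>v. of_real c * v) ` L) ((\<lambda>v. of_real c * v) ` M) S S' u)"

definition consists_of_pairs :: "complex set \<Rightarrow> nat \<Rightarrow> bool" where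
  "consists_of_pairs S s \<longleftrightarrow>
     finite S \<and> uminus ` S = S \<and> card ((\<lambda>v. {v, - v}) ` S) = s"

definition s_and_s'_form_with_temperament ::
  "nat \<Rightarrow> nat \<Rightarrow> nat \<Rightarrow> complex set \<Rightarrow> complex set \<Rightarrow> real \<Rightarrow> bool" where
  "s_and_s'_form_with_temperament s s' l L M \<tau> \<longleftrightarrow>
     (\<exists>S S' u. tempered_perfect_data l L M S S' u \<and>
        consists_of_pairs S s \<and> consists_of_pairs S' s' \<and> \<tau> = sqrt u)"


section \<open>Eisenstein integers\<close>

definition omega :: complex where
  "omega = exp (2 * of_real pi * \<i> / 3)"

definition eis :: "int \<Rightarrow> int \<Rightarrow> complex" where
  "eis a b = of_int a + of_int b * omega"

text \<open>The polynomial is non-negative on integers, so \<^const>\<open>nat\<close> does not truncate.\<close>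

definition eis_norm :: "int \<Rightarrow> int \<Rightarrow> nat" where
  "eis_norm a b = nat (a\<^sup>2 - a * b + b\<^sup>2)"

definition eis_units :: "complex set" where
  "eis_units = {1, - 1, omega, - omega, omega\<^sup>2, - (omega\<^sup>2)}"

definition unit_orbit :: "complex \<Rightarrow> complex set" where
  "unit_orbit v = (\<lambda>e. e * v) ` eis_units"

definition primitive_norms :: "nat set" where
  "primitive_norms = {eis_norm a b | a b. coprime a b}"

text \<open>Indexed from 1, as \<open>\<beta>\<^sub>1 = 1 < \<beta>\<^sub>2 = 3 < \<dots>\<close>; the value at 0 is irrelevant.\<close>

definition beta :: "nat \<Rightarrow> nat" where
  "beta i = enumerate primitive_norms (i - 1)"

text \<open>The value 0 means that there is no such index.\<close>

definition last_index_below :: "real \<Rightarrow> nat" where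
  "last_index_below x = Max (insert 0 {i. 1 \<le> i \<and> real (beta i) < x})"


section \<open>The algorithm\<close>

text \<open>A state consists of the list of remaining norms, the table assigning to each norm the
  orbits under it that are not crossed out, and the current set \<open>T\<close>. Table columns of norms
  that are not on the list are never read.\<close>

type_synonym alg_state = "nat set \<times> (nat \<Rightarrow> complex set set) \<times> nat set"

definition initial_norms :: "nat \<Rightarrow> nat set" where
  "initial_norms l = beta ` {last_index_below (3 / 4 * real l) + 1 .. last_index_below (real l)}"

definition initial_table :: "nat \<Rightarrow> complex set set" where
  "initial_table k = {unit_orbit (eis a b) | a b. coprime a b \<and> eis_norm a b = k}"

definition initial_state :: "nat \<Rightarrow> alg_state" where
  "initial_state l = (initial_norms l, initial_table, {})"

definition nearest_integer :: "int \<Rightarrow> real \<Rightarrow> bool" where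
  "nearest_integer t x \<longleftrightarrow> (\<forall>k::int. \<bar>x - of_int t\<bar> \<le> \<bar>x - of_int k\<bar>)"

text \<open>The sign of \<open>Im (z / v)\<close> tells on which side of the line \<open>R v\<close> the point \<open>z\<close> lies.\<close>

definition same_side :: "complex \<Rightarrow> complex \<Rightarrow> complex \<Rightarrow> bool" where
  "same_side v z w \<longleftrightarrow> Im (z / v) * Im (w / v) > 0"

text \<open>\<open>second_vector l a b p q\<close>: the vector \<open>p + q \<omega>\<close> is a possible \<open>w\<close>-hat for
  \<open>v = a + b \<omega>\<close>. It is a relation since \<open>c\<close>, \<open>d\<close> and, in case of a tie, \<open>t\<close> are choices.\<close>

definition second_vector :: "nat \<Rightarrow> int \<Rightarrow> int \<Rightarrow> int \<Rightarrow> int \<Rightarrow> bool" where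
  "second_vector l a b p q \<longleftrightarrow>
     (\<exists>c d z t0 t. a * d - b * c = 1 \<and>
        inner z (eis a b) = 0 \<and>
        same_side (eis a b) z (eis c d) \<and>
        cmod z = sqrt 3 * real l / (2 * cmod (eis a b)) \<and>
        of_real t0 = (z - of_nat l * eis c d) / eis a b \<and>
        nearest_integer t t0 \<and>
        eis p q = of_nat l * eis c d + of_int t * eis a b)"

text \<open>One passage through the loop. Subtracting from a table column whose norm has already
  left the list is harmless, but is excluded as in the algorithm.\<close>

inductive alg_step :: "nat \<Rightarrow> alg_state \<Rightarrow> alg_state \<Rightarrow> bool" for l :: nat where
  "\<lbrakk> Ls \<noteq> {};
     k0 = Min Ls;
     coprime a b; eis_norm a b = k0; unit_orbit (eis a b) \<in> tab k0;
     second_vector l a b p q;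
     k1 = eis_norm p q;
     tab1 = tab(k0 := tab k0 - {unit_orbit (eis a b)});
     tab2 = (if k1 \<in> Ls then tab1(k1 := tab1 k1 - {unit_orbit (eis p q)}) else tab1);
     Ls' = {k \<in> Ls. tab2 k \<noteq> {}} \<rbrakk>
   \<Longrightarrow> alg_step l (Ls, tab, T) (Ls', tab2, insert k0 T)"

definition alg_reachable :: "nat \<Rightarrow> alg_state \<Rightarrow> bool" where
  "alg_reachable l st \<longleftrightarrow> (alg_step l)\<^sup>*\<^sup>* (initial_state l) st"

text \<open>Whatever choices are made, the algorithm never gets stuck before the list of norms is
  empty and does not run forever.\<close>

definition alg_terminates :: "nat \<Rightarrow> bool" where
  "alg_terminates l \<longleftrightarrow>
     (\<forall>Ls tab T. alg_reachable l (Ls, tab, T) \<and> Ls \<noteq> {} \<longrightarrow> (\<exists>st. alg_step l (Ls, tab, T) st)) \<and>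
     \<not> (\<exists>run. run 0 = initial_state l \<and> (\<forall>i. alg_step l (run i) (run (Suc i))))"

definition alg_output :: "nat \<Rightarrow> nat set \<Rightarrow> bool" where
  "alg_output l T \<longleftrightarrow> (\<exists>tab. alg_reachable l ({}, tab, T))"

end

theory Submission
  imports Defs
begin

text \<open>The three pairs of shortest vectors of a 3-and-1 form force \<open>L\<close> to be \<open>Z[\<omega>]\<close> up to a
  similarity, and the six units determine the quadratic form. So the temperaments in question
  are the square roots of the norms \<open>u < l\<close> of primitive \<open>v\<close> that are, up to sign, the unique
  shortest vector of the sublattice of index \<open>l\<close> containing \<open>v\<close>.

  If \<open>w\<close> is a second vector of \<open>v\<close> and \<open>y\<close> is twice their inner product, then \<open>\<bar>y\<bar> \<le> N v\<close> and
  \<open>4 N v N w = y\<^sup>2 + 3 l\<^sup>2\<close>. Hence \<open>N w\<close> is at least \<open>3 l / 4\<close> when \<open>N v < l\<close>; if also \<open>N w < l\<close>,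
  then \<open>- v\<close> is in turn the only second vector of \<open>w\<close>; and \<open>N v = N w < l\<close> is impossible. So
  the primitive vectors in the table fall, up to units, into single ones and pairs, and the
  algorithm, which takes the smallest norm first and crosses out whole pairs, always chooses
  the shortest vector of its sublattice.\<close>

section \<open>Norm and pairing on the Eisenstein integers\<close>

text \<open>An integer copy of \<open>eis_norm\<close>: differences and ring identities are then
  available without truncation.\<close>

definition enorm :: "int \<Rightarrow> int \<Rightarrow> int" where
  "enorm a b = a\<^sup>2 - a * b + b\<^sup>2"

text \<open>Twice the dot product of \<open>a + b omega\<close> and \<open>p + q omega\<close>, that
  is, the polar form of \<open>enorm\<close>; the factor 2 keeps it integral.\<close>

definition epair :: "int \<Rightarrow> int \<Rightarrow> int \<Rightarrow> int \<Rightarrow> int" where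
  "epair a b p q = 2 * a * p - a * q - b * p + 2 * b * q"

lemma enorm_four: "4 * enorm a b = (2 * a - b)\<^sup>2 + 3 * b\<^sup>2"
  by (simp add: enorm_def power2_eq_square algebra_simps)

lemma enorm_nonneg: "enorm a b \<ge> 0"
proof -
  have "4 * enorm a b \<ge> 0" unfolding enorm_four by simp
  then show ?thesis by simp
qed

lemma enorm_eq_0_iff: "enorm a b = 0 \<longleftrightarrow> a = 0 \<and> b = 0"
proof
  assume "enorm a b = 0"
  then have "(2 * a - b)\<^sup>2 + 3 * b\<^sup>2 = 0" using enorm_four[of a b] by simp
  moreover have "(2 * a - b)\<^sup>2 \<ge> 0" "b\<^sup>2 \<ge> 0" by simp_all
  ultimately have "(2 * a - b)\<^sup>2 = 0" "b\<^sup>2 = 0" by linarith+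
  then show "a = 0 \<and> b = 0" by simp
qed (simp add: enorm_def)

lemma enorm_pos: "\<not> (a = 0 \<and> b = 0) \<Longrightarrow> enorm a b > 0"
  using enorm_nonneg[of a b] enorm_eq_0_iff[of a b] by linarith

lemma enorm_pos_coprime: "coprime a b \<Longrightarrow> enorm a b > 0"
  by (rule enorm_pos) auto

lemma int_eis_norm: "int (eis_norm a b) = enorm a b"
  using enorm_nonneg[of a b] by (simp add: eis_norm_def enorm_def)

lemma eis_norm_less_iff: "eis_norm a b < eis_norm p q \<longleftrightarrow> enorm a b < enorm p q"
  using int_eis_norm[of a b] int_eis_norm[of p q] by linarith

lemma eis_norm_eq_iff: "eis_norm a b = eis_norm p q \<longleftrightarrow> enorm a b = enorm p q"
  using int_eis_norm[of a b] int_eis_norm[of p q] by linarith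

lemma enorm_minus: "enorm (- a) (- b) = enorm a b"
  by (simp add: enorm_def)

lemma enorm_mult: "enorm (g * a) (g * b) = g\<^sup>2 * enorm a b"
  by (simp add: enorm_def power2_eq_square algebra_simps)

lemma epair_comm: "epair a b p q = epair p q a b"
  by (simp add: epair_def)

lemma enorm_combination:
  "enorm (m * a + n * p) (m * b + n * q) =
     m\<^sup>2 * enorm a b + m * n * epair a b p q + n\<^sup>2 * enorm p q"
  unfolding enorm_def epair_def by algebra

text \<open>The Gram determinant identity, multiplied by 4: the area spanned by two Eisenstein
  integers is their coordinate determinant times the area \<open>sqrt 3 / 2\<close> of a unit
  cell.\<close>

lemma enorm_gram:
  "4 * enorm a b * enorm p q = (epair a b p q)\<^sup>2 + 3 * (a * q - b * p)\<^sup>2"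
  unfolding enorm_def epair_def by algebra

section \<open>Coordinates of Eisenstein integers in the plane\<close>

lemma omega_eq: "omega = Complex (-1/2) (sqrt 3 / 2)"
proof -
  have "omega = cis (2 * pi / 3)"
    unfolding omega_def cis_conv_exp by (simp add: mult_ac)
  also have "\<dots> = Complex (cos (2 * pi / 3)) (sin (2 * pi / 3))" by (simp add: cis.ctr)
  also have "cos (2 * pi / 3) = - 1 / 2" using cos_120 by simp
  also have "sin (2 * pi / 3) = sqrt 3 / 2" using sin_120 by simp
  finally show ?thesis by simp
qed

lemma Re_omega: "Re omega = - 1 / 2" and Im_omega: "Im omega = sqrt 3 / 2"
  by (simp_all add: omega_eq)

lemma Re_eis: "Re (eis a b) = of_int a - of_int b / 2"
  and Im_eis: "Im (eis a b) = of_int b * sqrt 3 / 2"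
  by (simp_all add: eis_def Re_omega Im_omega)

lemma eis_inj: "eis a b = eis c d \<longleftrightarrow> a = c \<and> b = d"
  by (auto simp: complex_eq_iff Re_eis Im_eis)

lemma eis_add: "eis a b + eis c d = eis (a + c) (b + d)"
  by (simp add: eis_def algebra_simps)

lemma eis_minus: "- eis a b = eis (- a) (- b)"
  by (simp add: eis_def)

lemma eis_diff: "eis a b - eis c d = eis (a - c) (b - d)"
  by (simp add: eis_def algebra_simps)

lemma eis_scale: "of_int n * eis a b = eis (n * a) (n * b)"
  by (simp add: eis_def algebra_simps)

lemma eis_eq_0_iff: "eis a b = 0 \<longleftrightarrow> a = 0 \<and> b = 0"
  using eis_inj[of a b 0 0] by (simp add: eis_def)

lemma omega_square: "omega\<^sup>2 = - 1 - omega"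
  by (simp add: complex_eq_iff power2_eq_square Re_omega Im_omega)

lemma omega_times_eis: "omega * eis a b = eis (- b) (a - b)"
proof -
  have "omega * eis a b = of_int a * omega + of_int b * omega\<^sup>2"
    by (simp add: eis_def algebra_simps power2_eq_square)
  then show ?thesis by (simp add: omega_square eis_def algebra_simps)
qed

lemma inner_eis: "2 * inner (eis a b) (eis p q) = of_int (epair a b p q)"
  by (simp add: inner_complex_def Re_eis Im_eis epair_def field_simps)

lemma inner_eis_self: "inner (eis a b) (eis a b) = of_int (enorm a b)"
  using inner_eis[of a b a b] by (simp add: epair_def enorm_def power2_eq_square)

lemma cmod_eis_square: "(cmod (eis a b))\<^sup>2 = of_int (enorm a b)"
  using inner_eis_self[of a b] by (simp add: dot_square_norm)

section \<open>Second vectors in purely integral terms\<close>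

lemma nearest_integer_iff: "nearest_integer t x \<longleftrightarrow> \<bar>x - of_int t\<bar> \<le> 1 / 2"
proof
  assume "nearest_integer t x"
  then have "\<bar>x - of_int t\<bar> \<le> \<bar>x - of_int (round x)\<bar>" by (simp add: nearest_integer_def)
  also have "\<dots> \<le> 1 / 2" using of_int_round_abs_le[of x] by (simp add: abs_minus_commute)
  finally show "\<bar>x - of_int t\<bar> \<le> 1 / 2" .
next
  assume *: "\<bar>x - of_int t\<bar> \<le> 1 / 2"
  show "nearest_integer t x" unfolding nearest_integer_def
  proof
    fix k :: int
    show "\<bar>x - of_int t\<bar> \<le> \<bar>x - of_int k\<bar>"
    proof (cases "k = t")
      case False
      then have "\<bar>real_of_int k - of_int t\<bar> \<ge> 1" by linarith
      then show ?thesis using * by linarith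
    qed simp
  qed
qed

text \<open>With \<open>v = eis a b\<close> one has \<open>eis p q = z + (t - t0) v\<close>. Pairing
  with \<open>v\<close> kills \<open>z\<close> and leaves \<open>2 (t - t0) N v\<close>, so
  \<open>t\<close> is nearest to \<open>t0\<close> exactly when the pairing is at most
  \<open>N v\<close> in absolute value. The determinant \<open>l\<close> encodes the remaining data,
  since \<open>c\<close> and \<open>d\<close> can be recovered from a Bezout relation.\<close>

lemma second_vector_iff:
  assumes "l > 0"
  shows "second_vector l a b p q \<longleftrightarrow>
    coprime a b \<and> a * q - b * p = int l \<and> \<bar>epair a b p q\<bar> \<le> enorm a b"
proof
  assume "second_vector l a b p q"
  then obtain c d z t0 t where det: "a * d - b * c = 1" and orth: "inner z (eis a b) = 0"
    and t0: "of_real t0 = (z - of_nat l * eis c d) / eis a b"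
    and t: "nearest_integer t t0"
    and pq: "eis p q = of_nat l * eis c d + of_int t * eis a b"
    unfolding second_vector_def by blast
  have cop: "coprime a b"
  proof (rule coprimeI)
    fix e assume "e dvd a" "e dvd b"
    then have "e dvd a * d - b * c" by simp
    then show "is_unit e" using det by simp
  qed
  have "eis p q = eis (int l * c + t * a) (int l * d + t * b)"
    using pq eis_scale[of "int l" c d] eis_scale[of t a b] by (simp add: eis_add)
  then have p: "p = int l * c + t * a" and q: "q = int l * d + t * b" by (simp_all add: eis_inj)
  have "a * q - b * p = int l * (a * d - b * c)" unfolding p q by (simp add: algebra_simps)
  then have "a * q - b * p = int l" using det by simp
  moreover have "\<bar>epair a b p q\<bar> \<le> enorm a b"
  proof -
    have N: "enorm a b > 0" using cop by (rule enorm_pos_coprime)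
    then have nz: "eis a b \<noteq> 0" using enorm_eq_0_iff[of a b] eis_eq_0_iff[of a b] by simp
    have "z = of_nat l * eis c d + of_real t0 * eis a b" using t0 nz by (simp add: field_simps)
    then have "eis p q = z + of_real (of_int t - t0) * eis a b"
      using pq by (simp add: algebra_simps)
    then have "eis p q = z + (of_int t - t0) *\<^sub>R eis a b" by (simp add: scaleR_conv_of_real)
    then have "inner (eis p q) (eis a b) = (of_int t - t0) * of_int (enorm a b)"
      by (simp only: inner_add_left inner_scaleR_left orth inner_eis_self add_0)
    then have "of_int (epair a b p q) = 2 * (of_int t - t0) * of_int (enorm a b)"
      using inner_eis[of p q a b] epair_comm[of a b p q] by (simp add: algebra_simps)
    then have "\<bar>real_of_int (epair a b p q)\<bar> = 2 * \<bar>of_int t - t0\<bar> * of_int (enorm a b)"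
      by (simp only: abs_mult) (use N in simp)
    also have "\<dots> \<le> 1 * of_int (enorm a b)"
      using t N unfolding nearest_integer_iff
      by (intro mult_right_mono) (auto simp: abs_minus_commute)
    finally show ?thesis by linarith
  qed
  ultimately show "coprime a b \<and> a * q - b * p = int l \<and> \<bar>epair a b p q\<bar> \<le> enorm a b"
    using cop by simp
next
  assume "coprime a b \<and> a * q - b * p = int l \<and> \<bar>epair a b p q\<bar> \<le> enorm a b"
  then have cop: "coprime a b" and detl: "a * q - b * p = int l"
    and small: "\<bar>epair a b p q\<bar> \<le> enorm a b" by auto
  obtain x y where "x * a + y * b = 1" using cop
    by (metis bezout_int coprime_iff_gcd_eq_1)
  define c d where "c = - y" and "d = x"
  have det: "a * d - b * c = 1"
    using \<open>x * a + y * b = 1\<close> by (simp add: c_def d_def algebra_simps)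
  \<comment> \<open>Cramer's rule: the coefficient of \<open>v\<close> when \<open>eis p q\<close>
    is written in the basis \<open>v\<close>, \<open>eis c d\<close>.\<close>
  define t where "t = d * p - c * q"
  have p: "p = int l * c + t * a" and q: "q = int l * d + t * b"
  proof -
    have "int l * c + t * a = p * (a * d - b * c)"
      unfolding detl[symmetric] t_def by (simp add: algebra_simps)
    then show "p = int l * c + t * a" using det by simp
    have "int l * d + t * b = q * (a * d - b * c)"
      unfolding detl[symmetric] t_def by (simp add: algebra_simps)
    then show "q = int l * d + t * b" using det by simp
  qed
  have pq: "eis p q = of_nat l * eis c d + of_int t * eis a b"
    using eis_scale[of "int l" c d] eis_scale[of t a b] by (simp add: eis_add p q)
  define N where "N = real_of_int (enorm a b)"
  have N: "N > 0" using enorm_pos_coprime[OF cop] by (simp add: N_def)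
  then have nz: "eis a b \<noteq> 0"
    using enorm_eq_0_iff[of a b] eis_eq_0_iff[of a b] by (simp add: N_def)
  have NR: "(Re (eis a b))\<^sup>2 + (Im (eis a b))\<^sup>2 = N"
    using inner_eis_self[of a b] by (simp add: N_def inner_complex_def power2_eq_square)
  \<comment> \<open>A positive multiple of \<open>i v\<close> is perpendicular to \<open>v\<close>,
    and it lies on the side of \<open>eis c d\<close> because \<open>a d - b c = 1\<close> is
    positive. The factor is dictated by the prescribed length.\<close>
  define z where "z = Complex 0 (sqrt 3 * real l / (2 * N)) * eis a b"
  have quot: "z / eis a b = Complex 0 (sqrt 3 * real l / (2 * N))" using nz by (simp add: z_def)
  have Imw: "Im (eis c d / eis a b) = sqrt 3 / (2 * N)"
  proof -
    have "Im (eis c d / eis a b) =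
        (Im (eis c d) * Re (eis a b) - Re (eis c d) * Im (eis a b)) / N"
      using NR by (simp add: Im_divide)
    also have "Im (eis c d) * Re (eis a b) - Re (eis c d) * Im (eis a b)
        = sqrt 3 / 2 * of_int (a * d - b * c)"
      by (simp add: Re_eis Im_eis field_simps)
    finally show ?thesis using det by simp
  qed
  \<comment> \<open>\<open>z / v\<close> is purely imaginary and has the same imaginary part as
    \<open>l eis c d / v\<close>, so only this real part survives.\<close>
  define t0 where "t0 = - (real l) * Re (eis c d / eis a b)"
  define W where "W = eis c d / eis a b"
  have t0: "of_real t0 = (z - of_nat l * eis c d) / eis a b"
  proof -
    have "(z - of_nat l * eis c d) / eis a b = z / eis a b - of_real (real l) * W"
      by (simp add: diff_divide_distrib W_def)
    also have "\<dots> = of_real t0"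
      unfolding quot using Imw
      by (simp only: W_def[symmetric] t0_def complex_eq_iff) simp
    finally show ?thesis by simp
  qed
  have orth: "inner z (eis a b) = 0" by (simp add: z_def inner_complex_def)
  have side: "same_side (eis a b) z (eis c d)"
    unfolding same_side_def quot Imw using N assms by simp
  have cN: "N = (cmod (eis a b))\<^sup>2" by (simp add: N_def cmod_eis_square)
  have "cmod z = \<bar>sqrt 3 * real l / (2 * N)\<bar> * cmod (eis a b)"
    by (simp add: z_def norm_mult complex_norm)
  also have "\<bar>sqrt 3 * real l / (2 * N)\<bar> = sqrt 3 * real l / (2 * N)" using N by simp
  also have "\<dots> * cmod (eis a b) = sqrt 3 * real l / (2 * cmod (eis a b))"
    using nz by (simp add: cN power2_eq_square)
  finally have len: "cmod z = sqrt 3 * real l / (2 * cmod (eis a b))" .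
  have near: "nearest_integer t t0"
  proof -
    have "z = of_nat l * eis c d + of_real t0 * eis a b" using t0 nz by (simp add: field_simps)
    then have "eis p q = z + of_real (of_int t - t0) * eis a b"
      using pq by (simp add: algebra_simps)
    then have "eis p q = z + (of_int t - t0) *\<^sub>R eis a b" by (simp add: scaleR_conv_of_real)
    then have "inner (eis p q) (eis a b) = (of_int t - t0) * N"
      by (simp only: inner_add_left inner_scaleR_left orth inner_eis_self N_def add_0)
    then have "of_int (epair a b p q) = 2 * (of_int t - t0) * N"
      using inner_eis[of p q a b] epair_comm[of a b p q] by (simp add: algebra_simps)
    then have "2 * \<bar>of_int t - t0\<bar> * N = \<bar>real_of_int (epair a b p q)\<bar>"
      by (simp only: abs_mult) (use N in simp)
    also have "\<dots> \<le> 1 * N" using small unfolding N_def by linarith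
    finally have "2 * \<bar>of_int t - t0\<bar> \<le> 1" using N mult_right_le_imp_le by blast
    then show ?thesis unfolding nearest_integer_iff by (simp add: abs_minus_commute)
  qed
  show "second_vector l a b p q"
    unfolding second_vector_def using det orth side len t0 near pq by blast
qed

text \<open>A Bezout relation gives some vector of determinant \<open>l\<close>. Adding
  \<open>v\<close> keeps the determinant and shifts the pairing by \<open>2 N v\<close>, so the
  pairing can be brought into an interval of that length around 0.\<close>

lemma second_vector_exists:
  assumes "l > 0" "coprime a b"
  shows "\<exists>p q. second_vector l a b p q"
proof -
  obtain x y where xy: "x * a + y * b = 1" using assms(2)
    by (metis bezout_int coprime_iff_gcd_eq_1)
  define N where "N = enorm a b"
  have N: "N > 0" unfolding N_def using assms(2) by (rule enorm_pos_coprime)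
  define E where "E = epair a b (- int l * y) (int l * x)"
  \<comment> \<open>Division with remainder of \<open>E + N\<close> by \<open>2 N\<close>: the new
    pairing is the remainder minus \<open>N\<close>, hence between \<open>- N\<close> and
    \<open>N\<close>.\<close>
  define t where "t = - ((E + N) div (2 * N))"
  have "a * (int l * x + t * b) - b * (- int l * y + t * a) = int l * (x * a + y * b)"
    by (simp add: algebra_simps)
  then have det: "a * (int l * x + t * b) - b * (- int l * y + t * a) = int l" using xy by simp
  have "epair a b (- int l * y + t * a) (int l * x + t * b) = E + 2 * N * t"
    by (simp add: E_def N_def epair_def enorm_def power2_eq_square algebra_simps)
  also have "\<dots> = (E + N) mod (2 * N) - N"
    using div_mult_mod_eq[of "E + N" "2 * N"] by (simp add: t_def algebra_simps)
  finally have "\<bar>epair a b (- int l * y + t * a) (int l * x + t * b)\<bar> \<le> N"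
    using pos_mod_bound[of "2 * N" "E + N"] pos_mod_sign[of "2 * N" "E + N"] N by linarith
  then show ?thesis using det assms unfolding second_vector_iff[OF assms(1)] N_def by blast
qed

section \<open>Second vectors\<close>

lemma second_vector_gram:
  assumes "l > 0" "second_vector l a b p q"
  shows "4 * enorm a b * enorm p q = (epair a b p q)\<^sup>2 + 3 * (int l)\<^sup>2"
  using assms enorm_gram[of a b p q] by (simp add: second_vector_iff)

text \<open>For \<open>x = l\<close> the difference of the two sides is
  \<open>(l - u) (3 l - u)\<close>. The lemma is applied with either vector of a pair in the role of
  \<open>u\<close>.\<close>

lemma reduction_inequality:
  fixes u l :: int
  assumes "0 < u" "u < l" "x \<le> l"
  shows "4 * u * x < u\<^sup>2 + 3 * l\<^sup>2"
proof -
  have "4 * u * x \<le> 4 * u * l" using assms by (simp add: mult_left_mono)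
  moreover have "(l - u) * (3 * l - u) > 0" using assms by (intro mult_pos_pos) auto
  ultimately show ?thesis by (simp add: power2_eq_square algebra_simps)
qed

text \<open>By the Gram identity the squared pairing is \<open>4 N v N w - 3 l^2\<close>, which the
  reduction inequality puts below \<open>(N v)^2\<close>. So there was no tie in the choice of
  \<open>t\<close>.\<close>

lemma second_vector_strict:
  assumes "l > 0" "second_vector l a b p q" "enorm a b < int l" "enorm p q < int l"
  shows "\<bar>epair a b p q\<bar> < enorm a b"
proof -
  have cop: "coprime a b" and le: "\<bar>epair a b p q\<bar> \<le> enorm a b"
    using assms(1,2) by (simp_all add: second_vector_iff)
  have "4 * enorm a b * enorm p q < (enorm a b)\<^sup>2 + 3 * (int l)\<^sup>2"
    using reduction_inequality[of "enorm a b" "int l" "enorm p q"] enorm_pos_coprime[OF cop] assms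
    by simp
  then have "\<bar>epair a b p q\<bar>\<^sup>2 < (enorm a b)\<^sup>2"
    using second_vector_gram[OF assms(1,2)] by simp
  then show ?thesis by (rule power2_less_imp_less) (rule enorm_nonneg)
qed

text \<open>A vector parallel to a primitive one is an integral multiple of it; a Bezout relation
  computes the factor.\<close>

lemma multiple_of_coprime_pair:
  fixes a b x y :: int
  assumes "coprime a b" "a * y = b * x"
  obtains s where "x = s * a" "y = s * b"
proof -
  obtain m n where mn: "m * a + n * b = 1" using assms(1)
    by (metis bezout_int coprime_iff_gcd_eq_1)
  define s where "s = m * x + n * y"
  have "s * a = x * (m * a) + n * (a * y)" by (simp add: s_def algebra_simps)
  also have "\<dots> = x * (m * a + n * b)" unfolding assms(2) by (simp add: algebra_simps)
  finally have x: "x = s * a" using mn by simp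
  have "s * b = m * (b * x) + y * (n * b)" by (simp add: s_def algebra_simps)
  also have "\<dots> = y * (m * a + n * b)" unfolding assms(2)[symmetric] by (simp add: algebra_simps)
  finally have "y = s * b" using mn by simp
  with x show ?thesis by (rule that)
qed

text \<open>Equal determinants make two second vectors differ by some \<open>s v\<close>, which
  shifts the pairing by \<open>2 s N v\<close>. Both pairings lie between \<open>- N v\<close> and
  \<open>N v\<close>, the first one strictly, so \<open>s = 0\<close>.\<close>

lemma second_vector_unique:
  assumes "l > 0" "second_vector l a b p q" "second_vector l a b p' q'"
    and "enorm a b < int l" "enorm p q < int l"
  shows "p' = p \<and> q' = q"
proof -
  have cop: "coprime a b" and "a * q - b * p = int l" "a * q' - b * p' = int l"
    and le: "\<bar>epair a b p' q'\<bar> \<le> enorm a b"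
    using assms(1-3) by (simp_all add: second_vector_iff)
  then have eq: "a * (q' - q) = b * (p' - p)" by (simp add: algebra_simps)
  obtain s where "p' - p = s * a" "q' - q = s * b"
    using cop eq by (rule multiple_of_coprime_pair)
  then have p: "p' = p + s * a" and q: "q' = q + s * b" by simp_all
  have E: "epair a b p' q' = epair a b p q + 2 * s * enorm a b"
    unfolding p q epair_def enorm_def by algebra
  have strict: "\<bar>epair a b p q\<bar> < enorm a b" using second_vector_strict assms by blast
  have "\<bar>2 * s * enorm a b\<bar> < 2 * enorm a b" using le E strict by linarith
  then have "\<bar>s\<bar> * (2 * enorm a b) < 1 * (2 * enorm a b)"
    using enorm_pos_coprime[OF cop] by (simp add: abs_mult)
  then have "\<bar>s\<bar> < 1" using enorm_pos_coprime[OF cop] by (simp only: mult_less_cancel_right_pos)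
  then show ?thesis by (simp add: p q)
qed

lemma prime_square_not_le:
  assumes "prime l"
  shows "int l < (int l)\<^sup>2"
proof -
  have "1 < int l" using prime_gt_1_nat[OF assms] by simp
  then have "1 * int l < int l * int l" by (intro mult_strict_right_mono) auto
  then show ?thesis by (simp add: power2_eq_square)
qed

text \<open>A nontrivial gcd dividing the prime \<open>l\<close> is \<open>l\<close> itself, and
  then the norm is at least \<open>l^2 > l\<close>.\<close>

lemma coprime_of_small_enorm:
  assumes "prime l" "enorm p q \<le> int l" "gcd p q dvd int l" "enorm p q > 0"
  shows "coprime p q"
proof (rule ccontr)
  assume "\<not> coprime p q"
  then have "gcd p q \<noteq> 1" by (simp add: coprime_iff_gcd_eq_1)
  then have g: "gcd p q = int l" using assms(1,3)
    by (metis gcd_ge_0_int prime_int_iff prime_nat_int_transfer)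
  obtain p' q' where pq: "p = int l * p'" "q = int l * q'"
    using g by (metis dvdE gcd_dvd1 gcd_dvd2)
  have "(int l)\<^sup>2 * enorm p' q' = enorm p q" by (simp add: pq enorm_mult)
  moreover from this have "enorm p' q' > 0" using assms(4) enorm_nonneg[of p' q']
    by (cases "enorm p' q' = 0") auto
  then have "(int l)\<^sup>2 * 1 \<le> (int l)\<^sup>2 * enorm p' q'" by (intro mult_left_mono) auto
  ultimately show False using assms(2) prime_square_not_le[OF assms(1)] by linarith
qed

lemma second_vector_coprime:
  assumes "prime l" "second_vector l a b p q" "enorm p q \<le> int l"
  shows "coprime p q"
proof (rule coprime_of_small_enorm[OF assms(1,3)])
  have l: "l > 0" using prime_gt_0_nat[OF assms(1)] .
  have det: "a * q - b * p = int l" using assms(2) l by (simp add: second_vector_iff)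
  then show "gcd p q dvd int l" by (metis dvd_diff dvd_mult gcd_dvd1 gcd_dvd2)
  show "enorm p q > 0" by (rule enorm_pos) (use det l in auto)
qed

text \<open>Dropping the squared pairing from the Gram identity leaves
  \<open>3 l^2 <= 4 N v N w\<close>. So the partner of a short vector never falls below the range of
  the table.\<close>

lemma second_vector_enorm_ge:
  assumes "l > 0" "second_vector l a b p q" "enorm a b < int l"
  shows "3 * int l \<le> 4 * enorm p q"
proof -
  have pos: "enorm a b > 0"
    using assms by (simp add: second_vector_iff enorm_pos_coprime)
  have "int l * (3 * int l) \<le> 4 * enorm a b * enorm p q"
    using second_vector_gram[OF assms(1,2)] by (simp add: power2_eq_square)
  also have "\<dots> \<le> int l * (4 * enorm p q)"
    using mult_right_mono[of "enorm a b" "int l" "4 * enorm p q"] assms(3) enorm_nonneg[of p q]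
    by (simp add: mult_ac)
  finally show ?thesis using assms(1) by simp
qed

text \<open>Passing from \<open>(v, w)\<close> to \<open>(w, - v)\<close> keeps the determinant and
  negates the pairing; the reduction inequality, now with \<open>u = N w\<close>, supplies the
  required bound.\<close>

lemma second_vector_swap:
  assumes "prime l" "second_vector l a b p q" "enorm a b < int l" "enorm p q < int l"
  shows "second_vector l p q (- a) (- b)"
proof -
  have l: "l > 0" using prime_gt_0_nat[OF assms(1)] .
  have det: "a * q - b * p = int l" using assms(2) l by (simp add: second_vector_iff)
  have cop: "coprime p q" using second_vector_coprime assms by simp
  have "4 * enorm p q * enorm a b < (enorm p q)\<^sup>2 + 3 * (int l)\<^sup>2"
    using reduction_inequality[of "enorm p q" "int l" "enorm a b"] enorm_pos_coprime[OF cop] assms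
    by simp
  then have "\<bar>epair a b p q\<bar>\<^sup>2 < (enorm p q)\<^sup>2"
    using second_vector_gram[OF l assms(2)] by (simp add: mult_ac)
  then have "\<bar>epair a b p q\<bar> < enorm p q" by (rule power2_less_imp_less) (rule enorm_nonneg)
  moreover have "epair p q (- a) (- b) = - epair a b p q" by (simp add: epair_def)
  ultimately show ?thesis using det cop by (simp add: second_vector_iff[OF l] algebra_simps)
qed

text \<open>A tie would make \<open>3 l\<^sup>2\<close> the product of \<open>2 u - y\<close> and \<open>2 u + y\<close>, where \<open>u\<close> is the common
  norm and \<open>y \<le> u < l\<close> is the absolute value of the pairing.\<close>

lemma second_vector_no_tie:
  assumes "prime l" "second_vector l a b p q" "enorm a b < int l"
  shows "enorm a b \<noteq> enorm p q"
proof
  assume tie: "enorm a b = enorm p q"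
  have l: "l > 0" using prime_gt_0_nat[OF assms(1)] .
  have pl: "prime (int l)" using assms(1) by simp
  define u where "u = enorm a b"
  define y where "y = \<bar>epair a b p q\<bar>"
  have y: "0 \<le> y" "y \<le> u" using assms(2) by (simp_all add: second_vector_iff[OF l] y_def u_def)
  have "4 * u * u = y\<^sup>2 + 3 * (int l)\<^sup>2"
    using second_vector_gram[OF l assms(2)] tie by (simp add: u_def y_def)
  then have prod: "(2 * u - y) * (2 * u + y) = 3 * int l * int l"
    by (simp add: power2_eq_square algebra_simps)
  then have "int l dvd (2 * u - y) * (2 * u + y)" by simp
  then consider "int l dvd 2 * u - y" | "int l dvd 2 * u + y"
    using pl prime_dvd_mult_iff by blast
  then show False
  proof cases
    \<comment> \<open>Here \<open>0 < 2 u - y < 2 l\<close>, so this factor is \<open>l\<close> and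
      the other one is \<open>3 l\<close>, although \<open>2 u + y < 3 l\<close>.\<close>
    case 1
    then obtain k where k: "2 * u - y = int l * k" by blast
    have "u > 0" using assms(2) l unfolding u_def
      by (simp add: second_vector_iff enorm_pos_coprime)
    then have "int l * 0 < int l * k" "int l * k < int l * 2"
      using k y assms(3) unfolding u_def by linarith+
    then have "k = 1" using l by (simp only: mult_less_cancel_left_pos)
    then have "int l * (2 * u + y) = int l * (3 * int l)"
      using prod unfolding k by (simp add: mult_ac)
    then have "2 * u + y = 3 * int l" using l by simp
    then show False using y assms(3) unfolding u_def by linarith
  next
    \<comment> \<open>Here \<open>0 < 2 u + y < 3 l\<close>. The value \<open>l\<close> would make
      \<open>2 u - y = 3 l\<close> exceed \<open>2 u + y\<close>; the value \<open>2 l\<close> leads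
      to \<open>8 u = 7 l\<close>, so 8 would divide the prime \<open>l\<close>.\<close>
    case 2
    then obtain k where k: "2 * u + y = int l * k" by blast
    have "u > 0" using assms(2) l unfolding u_def
      by (simp add: second_vector_iff enorm_pos_coprime)
    then have "int l * 0 < int l * k" "int l * k < int l * 3"
      using k y assms(3) unfolding u_def by linarith+
    then have "k = 1 \<or> k = 2" using l by (simp only: mult_less_cancel_left_pos) linarith
    then show False
    proof
      assume "k = 1"
      then have "int l * (2 * u - y) = int l * (3 * int l)"
        using prod unfolding k by (simp add: mult_ac)
      then have "2 * u - y = 3 * int l" using l by simp
      then show False using k[unfolded \<open>k = 1\<close>] y l by linarith
    next
      assume "k = 2"
      then have "int l * (2 * (2 * u - y)) = int l * (3 * int l)"
        using prod unfolding k by (simp add: mult_ac)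
      then have "2 * (2 * u - y) = 3 * int l" using l by simp
      then have "8 * u = 7 * int l" using k \<open>k = 2\<close> by simp
      then have "8 dvd l" by presburger
      then have "2 dvd l" "l \<noteq> 2" by auto
      then show False using assms(1) primes_dvd_imp_eq two_is_prime_nat by blast
    qed
  qed
qed

text \<open>For primitive \<open>v\<close> one reduced partner decides: by
  \<open>minimal_vector_unique_minimum\<close> the condition implies that \<open>v\<close> and
  \<open>- v\<close> are the only shortest nonzero vectors of the sublattice.\<close>

definition minimal_vector :: "nat \<Rightarrow> int \<Rightarrow> int \<Rightarrow> bool" where
  "minimal_vector l a b \<longleftrightarrow>
     coprime a b \<and> (\<forall>p q. second_vector l a b p q \<longrightarrow> enorm a b < enorm p q)"

text \<open>Some second vector \<open>w\<close> is not longer than \<open>v\<close>, hence shorter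
  because ties are excluded. As \<open>- v\<close> is the only second vector of \<open>w\<close>,
  this \<open>w\<close> is minimal, and it is still in the range of the table.\<close>

lemma non_minimal_vector:
  assumes "prime l" "coprime a b" "enorm a b < int l" "\<not> minimal_vector l a b"
  obtains p q where "second_vector l p q (- a) (- b)" "enorm p q < enorm a b"
    "minimal_vector l p q" "3 * int l \<le> 4 * enorm p q"
proof -
  have l: "l > 0" using prime_gt_0_nat[OF assms(1)] .
  obtain p q where sv: "second_vector l a b p q" and "enorm p q \<le> enorm a b"
    using assms(2,4) unfolding minimal_vector_def by (meson not_le)
  then have less: "enorm p q < enorm a b"
    using second_vector_no_tie[OF assms(1) sv assms(3)] by linarith
  have swap: "second_vector l p q (- a) (- b)"
    using second_vector_swap[OF assms(1) sv] assms(3) less by simp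
  have "minimal_vector l p q" unfolding minimal_vector_def
  proof (intro conjI allI impI)
    show "coprime p q" using swap by (simp add: second_vector_iff[OF l])
    fix p' q' assume "second_vector l p q p' q'"
    then have "p' = - a \<and> q' = - b"
      using second_vector_unique[OF l swap] assms(3) less by (simp add: enorm_minus)
    then show "enorm p q < enorm p' q'" using less by (simp add: enorm_minus)
  qed
  then show ?thesis using that swap less second_vector_enorm_ge[OF l sv assms(3)] by blast
qed

section \<open>Unit orbits\<close>

text \<open>A unit rotates by a multiple of 60 degrees. In coordinates, given by \<open>f\<close>
  and \<open>g\<close>, this is an integral linear map that preserves pairing and determinant, so it
  respects everything in \<open>second_vector_iff\<close>.\<close>

lemma unit_times_eis:
  assumes "e \<in> eis_units"
  shows "\<exists>f g. (\<forall>a b. e * eis a b = eis (f a b) (g a b)) \<and>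
    (\<forall>a b p q. epair (f a b) (g a b) (f p q) (g p q) = epair a b p q \<and>
       f a b * g p q - g a b * f p q = a * q - b * p)"
proof -
  define good where "good f g \<longleftrightarrow> (\<forall>a b. e * eis a b = eis (f a b) (g a b)) \<and>
    (\<forall>a b p q. epair (f a b) (g a b) (f p q) (g p q) = epair a b p q \<and>
       f a b * g p q - g a b * f p q = a * q - b * p)" for f g
  have w2: "omega\<^sup>2 * eis a b = eis (b - a) (- a)" for a b
    by (simp only: power2_eq_square mult.assoc omega_times_eis) simp
  consider "e = 1" | "e = - 1" | "e = omega" | "e = - omega" | "e = omega\<^sup>2" | "e = - (omega\<^sup>2)"
    using assms unfolding eis_units_def by blast
  then have "\<exists>f g. good f g"
  proof cases
    case 1
    have "good (\<lambda>a b. a) (\<lambda>a b. b)" by (simp add: 1 good_def)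
    then show ?thesis by blast
  next
    case 2
    have "good (\<lambda>a b. - a) (\<lambda>a b. - b)" by (simp add: 2 good_def eis_minus epair_def)
    then show ?thesis by blast
  next
    case 3
    have "good (\<lambda>a b. - b) (\<lambda>a b. a - b)" by (simp add: 3 good_def omega_times_eis epair_def algebra_simps)
    then show ?thesis by blast
  next
    case 4
    have "good (\<lambda>a b. b) (\<lambda>a b. b - a)" by (simp add: 4 good_def omega_times_eis eis_minus epair_def algebra_simps)
    then show ?thesis by blast
  next
    case 5
    have "good (\<lambda>a b. b - a) (\<lambda>a b. - a)" 
      by (simp add: 5 good_def w2) (simp add: epair_def algebra_simps)
    then show ?thesis by blast
  next
    case 6
    have "good (\<lambda>a b. a - b) (\<lambda>a b. a)" 
      by (simp add: 6 good_def w2 eis_minus) (simp add: epair_def algebra_simps)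
    then show ?thesis by blast
  qed
  then show ?thesis unfolding good_def .
qed

lemma omega_cube: "omega ^ 3 = 1"
proof -
  have sq: "omega * omega = - 1 - omega" using omega_square by (simp add: power2_eq_square)
  have "omega ^ 3 = omega * (- 1 - omega)" unfolding sq[symmetric] by (simp add: power3_eq_cube)
  also have "\<dots> = - omega - omega * omega" by (simp add: algebra_simps)
  finally show ?thesis unfolding sq by simp
qed

lemma eis_units_mult: "x \<in> eis_units \<Longrightarrow> y \<in> eis_units \<Longrightarrow> x * y \<in> eis_units"
proof -
  have w: "omega * omega = omega\<^sup>2" "omega * omega\<^sup>2 = 1" "omega\<^sup>2 * omega = 1"
    "omega\<^sup>2 * omega\<^sup>2 = omega"
    using omega_cube by (simp_all add: power2_eq_square power3_eq_cube mult.assoc)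
  assume "x \<in> eis_units" "y \<in> eis_units"
  then show ?thesis unfolding eis_units_def
    by (elim insertE emptyE; hypsubst) (simp_all only: w mult_minus_left mult_minus_right minus_minus
        mult_1 mult_1_right, simp_all)
qed

lemma one_in_eis_units: "1 \<in> eis_units"
  by (simp add: eis_units_def)

lemma eis_units_inverse: "e \<in> eis_units \<Longrightarrow> \<exists>e'\<in>eis_units. e' * e = 1"
proof -
  have w: "omega * omega\<^sup>2 = 1" "omega\<^sup>2 * omega = 1"
    using omega_cube by (simp_all add: power2_eq_square power3_eq_cube mult.assoc)
  assume "e \<in> eis_units"
  then show ?thesis unfolding eis_units_def
    by (elim insertE emptyE; hypsubst) (simp_all add: w)
qed

lemma self_in_unit_orbit: "v \<in> unit_orbit v"
  unfolding unit_orbit_def using one_in_eis_units by force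

lemma unit_orbit_mult:
  assumes "e \<in> eis_units"
  shows "unit_orbit (e * v) = unit_orbit v"
proof
  show "unit_orbit (e * v) \<subseteq> unit_orbit v"
    unfolding unit_orbit_def using eis_units_mult[OF _ assms]
    by (auto simp: mult.assoc[symmetric] simp del: mult.assoc)
  obtain e' where e': "e' \<in> eis_units" "e' * e = 1" using eis_units_inverse[OF assms] by blast
  show "unit_orbit v \<subseteq> unit_orbit (e * v)"
  proof
    fix x assume "x \<in> unit_orbit v"
    then obtain f where "f \<in> eis_units" "x = f * v" unfolding unit_orbit_def by blast
    then have "f * e' \<in> eis_units" "x = (f * e') * (e * v)"
      using e' eis_units_mult by (auto simp: mult.assoc[symmetric])
    then show "x \<in> unit_orbit (e * v)" unfolding unit_orbit_def by blast
  qed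
qed

lemma unit_orbit_eq_obtain:
  assumes "unit_orbit v = unit_orbit w"
  obtains e where "e \<in> eis_units" "w = e * v"
  using assms self_in_unit_orbit[of w] unfolding unit_orbit_def by blast

lemma enorm_eq_of_unit_orbit_eq:
  assumes "unit_orbit (eis a b) = unit_orbit (eis a' b')"
  shows "enorm a b = enorm a' b'"
proof -
  obtain e where e: "e \<in> eis_units" "eis a' b' = e * eis a b"
    using assms by (rule unit_orbit_eq_obtain)
  obtain f g where f: "\<forall>a b. e * eis a b = eis (f a b) (g a b)"
    "\<forall>a b p q. epair (f a b) (g a b) (f p q) (g p q) = epair a b p q \<and>
       f a b * g p q - g a b * f p q = a * q - b * p"
    using unit_times_eis[OF e(1)] by blast
  have "f a b = a'" "g a b = b'" using f(1) e(2) by (simp_all add: eis_inj)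
  then have "epair a' b' a' b' = epair a b a b" using f(2) by metis
  then show ?thesis by (simp add: epair_def enorm_def power2_eq_square)
qed

text \<open>The unit that carries one representative to the other carries the second vector along.
  This is why the table can work with orbits.\<close>

lemma second_vector_unit_orbit:
  assumes "l > 0" "second_vector l a b p q" "coprime a' b'"
    and "unit_orbit (eis a b) = unit_orbit (eis a' b')"
  obtains p' q' where "second_vector l a' b' p' q'" "unit_orbit (eis p' q') = unit_orbit (eis p q)"
proof -
  obtain e where e: "e \<in> eis_units" "eis a' b' = e * eis a b"
    using assms(4) by (rule unit_orbit_eq_obtain)
  obtain f g where f: "\<forall>a b. e * eis a b = eis (f a b) (g a b)"
    "\<forall>a b p q. epair (f a b) (g a b) (f p q) (g p q) = epair a b p q \<and>
       f a b * g p q - g a b * f p q = a * q - b * p"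
    using unit_times_eis[OF e(1)] by blast
  have fab: "f a b = a'" "g a b = b'" using f(1) e(2) by (simp_all add: eis_inj)
  define p' q' where "p' = f p q" and "q' = g p q"
  have "epair a' b' p' q' = epair a b p q" "a' * q' - b' * p' = a * q - b * p"
    using f(2) fab unfolding p'_def q'_def by metis+
  moreover have "enorm a b = enorm a' b'" using assms(4) by (rule enorm_eq_of_unit_orbit_eq)
  ultimately have "second_vector l a' b' p' q'"
    using assms by (simp add: second_vector_iff)
  moreover have "eis p' q' = e * eis p q" using f(1) by (simp add: p'_def q'_def)
  then have "unit_orbit (eis p' q') = unit_orbit (eis p q)" using unit_orbit_mult[OF e(1)] by simp
  ultimately show ?thesis by (rule that)
qed

section \<open>The algorithm\<close>

lemma infinite_primitive_norms: "infinite primitive_norms"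
  unfolding infinite_nat_iff_unbounded_le
proof
  fix m :: nat
  have "int (eis_norm 1 (int m + 1)) = int (m\<^sup>2 + m + 1)"
    unfolding int_eis_norm enorm_def by (simp add: power2_eq_square algebra_simps)
  then have "m \<le> eis_norm 1 (int m + 1)" unfolding of_nat_eq_iff by simp
  moreover have "eis_norm 1 (int m + 1) \<in> primitive_norms"
    unfolding primitive_norms_def by force
  ultimately show "\<exists>n\<ge>m. n \<in> primitive_norms" by blast
qed

text \<open>\<open>beta\<close> is increasing, so the indices with \<open>beta i < x\<close> form an
  initial segment. It is bounded, so \<open>Max\<close> is meaningful, and the inserted 0 is its
  value when the segment is empty.\<close>

lemma le_last_index_below_iff:
  assumes "1 \<le> i"
  shows "i \<le> last_index_below x \<longleftrightarrow> real (beta i) < x"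
proof -
  define A where "A = {i. 1 \<le> i \<and> real (beta i) < x}"
  \<comment> \<open>\<open>enumerate\<close> counts from 0 and \<open>beta\<close> from 1, so only
    \<open>i - 1 <= beta i\<close> is available; hence the extra 1.\<close>
  have "i \<le> nat \<lceil>x\<rceil> + 1" if "i \<in> A" for i
  proof -
    have "i - 1 \<le> beta i"
      unfolding beta_def by (rule le_enumerate[OF infinite_primitive_norms])
    moreover have "real (beta i) < x" using that by (simp add: A_def)
    ultimately show ?thesis by linarith
  qed
  then have fin: "finite A" by (meson finite_nat_set_iff_bounded_le)
  show ?thesis
  proof
    assume i: "i \<le> last_index_below x"
    have n: "last_index_below x = Max (insert 0 A)" by (simp add: last_index_below_def A_def)
    have "Max (insert 0 A) \<in> insert 0 A" using fin by (intro Max_in) auto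
    then have "last_index_below x \<in> A" using i assms n by auto
    then have "real (beta (last_index_below x)) < x" by (simp add: A_def)
    moreover have "beta i \<le> beta (last_index_below x)"
      unfolding beta_def using i by (simp add: enumerate_mono_le_iff[OF infinite_primitive_norms])
    ultimately show "real (beta i) < x" by linarith
  next
    assume "real (beta i) < x"
    then have "i \<in> insert 0 A" using assms by (simp add: A_def)
    then show "i \<le> last_index_below x"
      unfolding last_index_below_def A_def[symmetric] using fin by (intro Max_ge) auto
  qed
qed

lemma initial_norms_eq: "initial_norms l = {k \<in> primitive_norms. 3 * l \<le> 4 * k \<and> k < l}"
proof -
  have "{last_index_below (3 / 4 * real l) + 1 .. last_index_below (real l)} =
      {i. 1 \<le> i \<and> 3 * l \<le> 4 * beta i \<and> beta i < l}" (is "?I = ?J")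
  proof (intro set_eqI)
    fix i
    show "i \<in> ?I \<longleftrightarrow> i \<in> ?J"
    proof (cases "1 \<le> i")
      case True
      have "i \<in> ?I \<longleftrightarrow> \<not> i \<le> last_index_below (3 / 4 * real l) \<and> i \<le> last_index_below (real l)"
        by auto
      also have "\<dots> \<longleftrightarrow> \<not> real (beta i) < 3 / 4 * real l \<and> real (beta i) < real l"
        by (simp only: le_last_index_below_iff[OF True])
      also have "\<dots> \<longleftrightarrow> i \<in> ?J" using True by auto
      finally show ?thesis .
    qed auto
  qed
  then have "initial_norms l = beta ` ?J" by (simp add: initial_norms_def)
  also have "\<dots> = {k \<in> primitive_norms. 3 * l \<le> 4 * k \<and> k < l}"
  proof (intro set_eqI iffI)
    fix k assume "k \<in> {k \<in> primitive_norms. 3 * l \<le> 4 * k \<and> k < l}"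
    moreover then obtain n where "enumerate primitive_norms n = k"
      using enumerate_Ex[OF infinite_primitive_norms] by blast
    \<comment> \<open>The shift accounts for \<open>beta\<close> starting at index 1.\<close>
    then have "beta (Suc n) = k" by (simp add: beta_def)
    ultimately show "k \<in> beta ` ?J" by (intro image_eqI[of _ _ "Suc n"]) auto
  qed (auto simp: beta_def enumerate_in_set[OF infinite_primitive_norms])
  finally show ?thesis .
qed

lemma eis_norm_in_initial_norms_iff:
  assumes "coprime a b"
  shows "eis_norm a b \<in> initial_norms l \<longleftrightarrow> 3 * int l \<le> 4 * enorm a b \<and> enorm a b < int l"
proof -
  have "eis_norm a b \<in> primitive_norms" using assms unfolding primitive_norms_def by blast
  then have "eis_norm a b \<in> initial_norms l \<longleftrightarrow> 3 * l \<le> 4 * eis_norm a b \<and> eis_norm a b < l"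
    by (simp add: initial_norms_eq)
  then show ?thesis using int_eis_norm[of a b] by linarith
qed

lemma finite_initial_norms: "finite (initial_norms l)"
  by (simp add: initial_norms_def)

text \<open>\<open>2 N = (a - b)^2 + a^2 + b^2\<close> bounds both coordinates in terms of the
  norm.\<close>

lemma finite_initial_table: "finite (initial_table k)"
proof -
  define I where "I = {- (2 * int k)..2 * int k}"
  have bound: "\<bar>a\<bar> \<le> 2 * int (eis_norm a b) \<and> \<bar>b\<bar> \<le> 2 * int (eis_norm a b)" for a b
  proof -
    have "2 * enorm a b = (a - b)\<^sup>2 + a\<^sup>2 + b\<^sup>2"
      by (simp add: enorm_def power2_eq_square algebra_simps)
    moreover have "(a - b)\<^sup>2 \<ge> 0" "a\<^sup>2 \<ge> 0" "b\<^sup>2 \<ge> 0" by simp_all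
    moreover have "\<bar>x\<bar> \<le> x\<^sup>2" for x :: int
    proof (cases "x = 0")
      case False
      then have "\<bar>x\<bar> * 1 \<le> \<bar>x\<bar> * \<bar>x\<bar>" by (intro mult_left_mono) auto
      then show ?thesis by (simp add: power2_eq_square)
    qed simp
    from this[of a] this[of b] have "\<bar>a\<bar> \<le> a\<^sup>2" "\<bar>b\<bar> \<le> b\<^sup>2" .
    ultimately show ?thesis unfolding int_eis_norm by linarith
  qed
  have "initial_table k \<subseteq> (\<lambda>(a, b). unit_orbit (eis a b)) ` (I \<times> I)"
  proof
    fix x assume "x \<in> initial_table k"
    then obtain a b where "x = unit_orbit (eis a b)" "eis_norm a b = k"
      unfolding initial_table_def by blast
    moreover then have "(a, b) \<in> I \<times> I" using bound[of a b] by (auto simp: I_def)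
    ultimately show "x \<in> (\<lambda>(a, b). unit_orbit (eis a b)) ` (I \<times> I)" by force
  qed
  then show ?thesis by (rule finite_subset) (simp add: I_def)
qed

text \<open>The central clause says that a crossed-out minimal orbit has its norm in
  \<open>T\<close> and its partner crossed out as well. Contrapositively, a surviving non-minimal
  orbit still has its shorter partner in the table. The last clause says that only norms of minimal
  vectors enter \<open>T\<close>.\<close>

definition alg_invariant :: "nat \<Rightarrow> alg_state \<Rightarrow> bool" where
  "alg_invariant l = (\<lambda>(Ls, tab, T).
     Ls \<subseteq> initial_norms l \<and> (\<forall>k\<in>Ls. tab k \<noteq> {}) \<and> (\<forall>k. tab k \<subseteq> initial_table k) \<and>
     (\<forall>k\<in>initial_norms l - Ls. tab k = {}) \<and>
     (\<forall>a b. minimal_vector l a b \<and> eis_norm a b \<in> initial_norms l \<and>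
        unit_orbit (eis a b) \<notin> tab (eis_norm a b) \<longrightarrow>
        eis_norm a b \<in> T \<and>
        (\<forall>p q. second_vector l a b p q \<and> eis_norm p q \<in> initial_norms l \<longrightarrow>
           unit_orbit (eis p q) \<notin> tab (eis_norm p q))) \<and>
     (\<forall>k\<in>T. k \<in> initial_norms l \<and> (\<exists>a b. minimal_vector l a b \<and> eis_norm a b = k)))"

text \<open>The number of orbits not yet crossed out, which is the termination measure.\<close>

definition table_size :: "nat \<Rightarrow> alg_state \<Rightarrow> nat" where
  "table_size l = (\<lambda>(Ls, tab, T). card (Sigma (initial_norms l) tab))"

lemma alg_invariant_initial: "alg_invariant l (initial_state l)"
proof -
  have "initial_table k \<noteq> {}" if "k \<in> initial_norms l" for k
    using that unfolding initial_norms_eq primitive_norms_def initial_table_def by blast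
  moreover have "unit_orbit (eis a b) \<in> initial_table (eis_norm a b)" if "minimal_vector l a b" for a b
    using that unfolding minimal_vector_def initial_table_def by blast
  ultimately show ?thesis by (auto simp: alg_invariant_def initial_state_def)
qed

text \<open>The vector chosen under the least norm is minimal, so its norm may enter
  \<open>T\<close>. Of the at most two orbits removed, that of \<open>v\<close> loses its partner in
  the same step, and that of \<open>w\<close> is not minimal because \<open>v\<close> is shorter. At
  least the orbit of \<open>v\<close> leaves the table.\<close>

lemma alg_step_invariant:
  assumes "prime l" and step: "alg_step l st st'" and inv: "alg_invariant l st"
  shows "alg_invariant l st' \<and> table_size l st' < table_size l st"
  using step
proof cases
  case (1 Ls k0 a b tab p q k1 tab1 tab2 Ls' T)
  have l: "l > 0" using prime_gt_0_nat[OF assms(1)] .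
  have inv: "Ls \<subseteq> initial_norms l" "\<forall>k\<in>Ls. tab k \<noteq> {}" "\<forall>k. tab k \<subseteq> initial_table k"
    "\<forall>k\<in>initial_norms l - Ls. tab k = {}"
    and crossed: "\<And>a b. minimal_vector l a b \<Longrightarrow> eis_norm a b \<in> initial_norms l \<Longrightarrow>
        unit_orbit (eis a b) \<notin> tab (eis_norm a b) \<Longrightarrow> eis_norm a b \<in> T \<and>
        (\<forall>p q. second_vector l a b p q \<and> eis_norm p q \<in> initial_norms l \<longrightarrow>
           unit_orbit (eis p q) \<notin> tab (eis_norm p q))"
    and T: "\<forall>k\<in>T. k \<in> initial_norms l \<and> (\<exists>a b. minimal_vector l a b \<and> eis_norm a b = k)"
    using inv[unfolded 1(1) alg_invariant_def prod.case] by blast+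
  have fin: "finite Ls" using inv(1) finite_initial_norms finite_subset by blast
  have k0: "k0 \<in> Ls" "\<And>k. k \<in> Ls \<Longrightarrow> k0 \<le> k" using 1(3,4) fin by auto
  have small: "enorm a b < int l"
    using k0(1) inv(1) 1(5,6) eis_norm_in_initial_norms_iff by blast
  have minimal: "minimal_vector l a b"
  proof (rule ccontr)
    assume "\<not> minimal_vector l a b"
    then obtain p' q' where pq: "second_vector l p' q' (- a) (- b)" "enorm p' q' < enorm a b"
      "minimal_vector l p' q'" "3 * int l \<le> 4 * enorm p' q'"
      using non_minimal_vector[OF assms(1) 1(5) small] by metis
    \<comment> \<open>The shorter partner is in range but below \<open>Min Ls\<close>, so its column
      is empty. By the invariant its own partner \<open>- v\<close> is crossed out too, which
      contradicts the choice of \<open>v\<close>.\<close>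
    have "eis_norm p' q' \<in> initial_norms l"
      using pq small by (simp add: eis_norm_in_initial_norms_iff minimal_vector_def)
    moreover have "eis_norm p' q' < k0" using pq(2) 1(6) by (simp add: eis_norm_less_iff[symmetric])
    then have "eis_norm p' q' \<notin> Ls" using k0(2) by fastforce
    ultimately have "unit_orbit (eis p' q') \<notin> tab (eis_norm p' q')" using inv(4) by blast
    then have *: "\<forall>p q. second_vector l p' q' p q \<and> eis_norm p q \<in> initial_norms l \<longrightarrow>
           unit_orbit (eis p q) \<notin> tab (eis_norm p q)"
      using crossed pq(3) \<open>eis_norm p' q' \<in> initial_norms l\<close> by blast
    have "eis_norm (- a) (- b) = k0" using 1(6) by (simp add: eis_norm_def)
    moreover have "unit_orbit (eis (- a) (- b)) = unit_orbit (eis a b)"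
      using unit_orbit_mult[of "- 1" "eis a b"] by (simp add: eis_minus eis_units_def)
    ultimately show False using * pq(1) 1(7) k0(1) inv(1) by (metis subsetD)
  qed
  have tab2_sub: "tab2 k \<subseteq> tab k" for k using 1(10,11) by auto
  have tab2_v: "unit_orbit (eis a b) \<notin> tab2 k0" using 1(10,11) by auto
  \<comment> \<open>When \<open>k1\<close> is in the initial range but no longer on the list, its
    column was already empty.\<close>
  have tab2_w: "unit_orbit (eis p q) \<notin> tab2 k1" if "k1 \<in> initial_norms l"
    using 1(10,11) that inv(4) tab2_sub[of k1] by (cases "k1 \<in> Ls") auto
  have removed: "(k = k0 \<and> x = unit_orbit (eis a b)) \<or> (k = k1 \<and> k1 \<in> Ls \<and> x = unit_orbit (eis p q))"
    if "x \<in> tab k" "x \<notin> tab2 k" for x k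
    using that 1(10,11) by (auto split: if_splits)
  have new: "eis_norm a' b' \<in> insert k0 T \<and>
      (\<forall>p q. second_vector l a' b' p q \<and> eis_norm p q \<in> initial_norms l \<longrightarrow>
           unit_orbit (eis p q) \<notin> tab2 (eis_norm p q))"
    if min': "minimal_vector l a' b'" and init': "eis_norm a' b' \<in> initial_norms l"
      and "unit_orbit (eis a' b') \<notin> tab2 (eis_norm a' b')" for a' b'
  proof (cases "unit_orbit (eis a' b') \<in> tab (eis_norm a' b')")
    case False
    then show ?thesis using crossed[OF min' init'] tab2_sub by blast
  next
    case True
    have cop': "coprime a' b'" using min' by (simp add: minimal_vector_def)
    from removed[OF True that(3)] show ?thesis
    proof
      assume v: "eis_norm a' b' = k0 \<and> unit_orbit (eis a' b') = unit_orbit (eis a b)"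
      have "unit_orbit (eis p' q') \<notin> tab2 (eis_norm p' q')"
        if sv: "second_vector l a' b' p' q'" and init: "eis_norm p' q' \<in> initial_norms l" for p' q'
      proof -
        \<comment> \<open>\<open>a'\<close>, \<open>b'\<close> may be another representative of the
          chosen orbit. Rotating its partner back and using uniqueness identifies it with the
          removed \<open>p\<close>, \<open>q\<close>.\<close>
        obtain p2 q2 where sv2: "second_vector l a b p2 q2"
          and orb: "unit_orbit (eis p2 q2) = unit_orbit (eis p' q')"
          using second_vector_unit_orbit[OF l sv 1(5)] v by metis
        have norm: "enorm p2 q2 = enorm p' q'" using orb by (rule enorm_eq_of_unit_orbit_eq)
        have "eis_norm p' q' < l" using init by (simp add: initial_norms_eq)
        then have "enorm p2 q2 < int l" using norm int_eis_norm[of p' q'] by linarith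
        then have "p = p2 \<and> q = q2" using second_vector_unique[OF l sv2 1(8) small] by blast
        then have "k1 = eis_norm p' q'" "unit_orbit (eis p q) = unit_orbit (eis p' q')"
          using 1(9) norm orb by (simp_all add: eis_norm_eq_iff)
        then show ?thesis using tab2_w init by metis
      qed
      then show ?thesis using v by blast
    next
      assume w: "eis_norm a' b' = k1 \<and> k1 \<in> Ls \<and> unit_orbit (eis a' b') = unit_orbit (eis p q)"
      then have "k1 < l" using inv(1) by (auto simp: initial_norms_eq)
      then have "enorm p q < int l" using 1(9) int_eis_norm[of p q] by linarith
      \<comment> \<open>The second vector of \<open>w\<close> is \<open>- v\<close>, which is
        shorter; so \<open>w\<close> and its rotations cannot be minimal.\<close>
      then have swap: "second_vector l p q (- a) (- b)"
        by (rule second_vector_swap[OF assms(1) 1(8) small])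
      obtain p2 q2 where sv2: "second_vector l a' b' p2 q2"
        and orb: "unit_orbit (eis p2 q2) = unit_orbit (eis (- a) (- b))"
        using second_vector_unit_orbit[OF l swap cop'] w by metis
      have "enorm a' b' < enorm p2 q2" using min' sv2 by (simp add: minimal_vector_def)
      moreover have "enorm p2 q2 = enorm a b"
        using enorm_eq_of_unit_orbit_eq[OF orb] by (simp add: enorm_minus)
      moreover have "enorm a' b' = enorm p q" using w 1(9) by (simp add: eis_norm_eq_iff)
      moreover have "enorm a b < enorm p q" using minimal 1(8) by (simp add: minimal_vector_def)
      ultimately show ?thesis by simp
    qed
  qed
  have "alg_invariant l st'"
    unfolding 1(2) alg_invariant_def prod.case
  proof (intro conjI)
    show "Ls' \<subseteq> initial_norms l" "\<forall>k\<in>Ls'. tab2 k \<noteq> {}" using 1(12) inv(1) by auto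
    show "\<forall>k. tab2 k \<subseteq> initial_table k" using tab2_sub inv(3) by blast
    show "\<forall>k\<in>initial_norms l - Ls'. tab2 k = {}"
      using tab2_sub inv(4) unfolding 1(12) by blast
    show "\<forall>k\<in>insert k0 T. k \<in> initial_norms l \<and> (\<exists>a b. minimal_vector l a b \<and> eis_norm a b = k)"
      using T minimal k0(1) inv(1) 1(6) by blast
  qed (use new in blast)
  moreover have "table_size l st' < table_size l st"
    unfolding 1(1,2) table_size_def prod.case
  proof (rule psubset_card_mono)
    show "finite (Sigma (initial_norms l) tab)"
      using inv(3) finite_initial_table finite_initial_norms
      by (intro finite_SigmaI) (auto intro: finite_subset)
    have "(k0, unit_orbit (eis a b)) \<in> Sigma (initial_norms l) tab"
      using k0(1) inv(1) 1(7) by blast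
    then show "Sigma (initial_norms l) tab2 \<subset> Sigma (initial_norms l) tab"
      using tab2_sub tab2_v by blast
  qed
  ultimately show ?thesis ..
qed

lemma alg_reachable_invariant:
  assumes "prime l" "alg_reachable l st"
  shows "alg_invariant l st"
  using assms(2) unfolding alg_reachable_def
  by (induction rule: rtranclp_induct)
    (use alg_invariant_initial alg_step_invariant[OF assms(1)] in blast)+

text \<open>A column on the list is nonempty and every primitive vector has a second vector, so the
  loop is never stuck. An infinite run would decrease \<open>table_size\<close> forever.\<close>

lemma alg_terminates:
  assumes "prime l"
  shows "alg_terminates l"
  unfolding alg_terminates_def
proof (intro conjI allI impI notI)
  fix Ls tab T assume "alg_reachable l (Ls, tab, T) \<and> Ls \<noteq> {}"
  then have "alg_invariant l (Ls, tab, T)" and ne: "Ls \<noteq> {}"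
    using alg_reachable_invariant[OF assms] by blast+
  then have inv: "Ls \<subseteq> initial_norms l" "\<forall>k\<in>Ls. tab k \<noteq> {}" "\<forall>k. tab k \<subseteq> initial_table k"
    by (simp_all add: alg_invariant_def)
  have "finite Ls" using inv(1) finite_initial_norms by (rule finite_subset)
  then have "Min Ls \<in> Ls" using ne by simp
  then obtain x where x: "x \<in> tab (Min Ls)" "x \<in> initial_table (Min Ls)"
    using inv(2,3) by blast
  then obtain a b where ab: "x = unit_orbit (eis a b)" "coprime a b" "eis_norm a b = Min Ls"
    unfolding initial_table_def by blast
  obtain p q where "second_vector l a b p q"
    using second_vector_exists[OF prime_gt_0_nat[OF assms] ab(2)] by blast
  then show "\<exists>st. alg_step l (Ls, tab, T) st"
    using alg_step.intros[OF ne refl ab(2,3) _ _ refl refl refl refl] x(1) ab(1) by blast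
next
  assume "\<exists>run. run 0 = initial_state l \<and> (\<forall>i. alg_step l (run i) (run (Suc i)))"
  then obtain run where run: "run 0 = initial_state l" "\<And>i. alg_step l (run i) (run (Suc i))"
    by blast
  have inv: "alg_invariant l (run i)" for i
  proof (induction i)
    case 0
    show ?case unfolding run(1) by (rule alg_invariant_initial)
  next
    case (Suc i)
    show ?case using alg_step_invariant[OF assms run(2) Suc] by blast
  qed
  have "table_size l (run i) + i \<le> table_size l (run 0)" for i
  proof (induction i)
    case (Suc i)
    have "table_size l (run (Suc i)) < table_size l (run i)"
      using alg_step_invariant[OF assms run(2) inv] by blast
    then show ?case using Suc by simp
  qed simp
  from this[of "Suc (table_size l (run 0))"] show False by simp
qed

text \<open>Once the list is empty, every column in range is empty, so the clause on crossed-out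
  minimal orbits applies to all minimal vectors in range.\<close>

lemma alg_output_eq:
  assumes "prime l" "alg_output l T"
  shows "T = {k \<in> initial_norms l. \<exists>a b. minimal_vector l a b \<and> eis_norm a b = k}"
proof -
  obtain tab where "alg_reachable l ({}, tab, T)"
    using assms(2) unfolding alg_output_def by blast
  note inv = alg_reachable_invariant[OF assms(1) this, unfolded alg_invariant_def prod.case]
  have "\<forall>k\<in>initial_norms l - {}. tab k = {}" using inv by (elim conjE)
  then have left: "unit_orbit (eis a b) \<notin> tab (eis_norm a b)"
    if "eis_norm a b \<in> initial_norms l" for a b using that by blast
  have "\<forall>k\<in>T. k \<in> initial_norms l \<and> (\<exists>a b. minimal_vector l a b \<and> eis_norm a b = k)"
    using inv by (elim conjE)
  moreover have "eis_norm a b \<in> T" if "minimal_vector l a b" "eis_norm a b \<in> initial_norms l" for a b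
    using inv that left[OF that(2)] by blast
  ultimately show ?thesis by blast
qed

section \<open>From forms to minimal vectors\<close>

lemma lattice_zero: "is_lattice L \<Longrightarrow> 0 \<in> L"
  unfolding is_lattice_def by (force intro: exI[of _ 0])

lemma lattice_diff:
  assumes "is_lattice L" "v \<in> L" "w \<in> L"
  shows "v - w \<in> L"
proof -
  obtain x y where L: "L = {of_int m * x + of_int n * y | m n. True}"
    using assms(1) unfolding is_lattice_def by blast
  obtain m n m' n' where "v = of_int m * x + of_int n * y" "w = of_int m' * x + of_int n' * y"
    using assms(2,3) unfolding L by blast
  then have "v - w = of_int (m - m') * x + of_int (n - n') * y" by (simp add: algebra_simps)
  then show ?thesis unfolding L by blast
qed

text \<open>Serves lattices and their rescaled images alike.\<close>

locale subgroup_of_plane =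
  fixes L :: "complex set"
  assumes zero: "0 \<in> L" and diff: "v \<in> L \<Longrightarrow> w \<in> L \<Longrightarrow> v - w \<in> L"
begin

lemma uminus: "v \<in> L \<Longrightarrow> - v \<in> L"
  using diff[OF zero] by simp

lemma add: "v \<in> L \<Longrightarrow> w \<in> L \<Longrightarrow> v + w \<in> L"
  using diff[of v "- w"] uminus by simp

lemma sum: "(\<And>i. i \<in> I \<Longrightarrow> f i \<in> L) \<Longrightarrow> sum f I \<in> L"
  by (induction I rule: infinite_finite_induct) (auto intro: zero add)

lemma int_mult:
  assumes "v \<in> L"
  shows "of_int n * v \<in> L"
proof (induction n rule: int_induct[of _ 0])
  case base
  show ?case by (simp add: zero)
next
  case (step1 i)
  then show ?case using add[OF step1(2) assms] by (simp add: algebra_simps)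
next
  case (step2 i)
  then show ?case using diff[OF step2(2) assms] by (simp add: algebra_simps)
qed

lemma coset_eq_iff: "(+) v ` L = (+) w ` L \<longleftrightarrow> v - w \<in> L"
proof
  assume "(+) v ` L = (+) w ` L"
  moreover have "v \<in> (+) v ` L" using zero by force
  ultimately show "v - w \<in> L" by auto
next
  have le: "(+) v ` L \<subseteq> (+) w ` L" if "v - w \<in> L" for v w
  proof
    fix x assume "x \<in> (+) v ` L"
    then obtain m where "m \<in> L" "x = v + m" by blast
    then show "x \<in> (+) w ` L" using add[OF that, of m] by (intro image_eqI[of _ _ "v - w + m"]) auto
  qed
  assume "v - w \<in> L"
  then show "(+) v ` L = (+) w ` L" using le[of v w] le[of w v] uminus[of "v - w"] by auto
qed

end

lemma subgroup_of_lattice: "is_lattice L \<Longrightarrow> subgroup_of_plane L"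
  by unfold_locales (auto intro: lattice_zero lattice_diff)

text \<open>Translation by \<open>x\<close> permutes the cosets; add up representatives of all of them before and
  after the translation.\<close>

lemma index_mult_mem_sublattice:
  assumes "is_lattice L" "is_sublattice_of_index l M L" "x \<in> L"
  shows "of_nat l * x \<in> M"
proof -
  interpret L: subgroup_of_plane L using assms(1) by (rule subgroup_of_lattice)
  interpret M: subgroup_of_plane M
    using assms(2) unfolding is_sublattice_of_index_def by (blast intro: subgroup_of_lattice)
  define C where "C = (\<lambda>v. (+) v ` M) ` L"
  have fin: "finite C" and card: "card C = l"
    using assms(2) unfolding is_sublattice_of_index_def C_def by blast+
  define rep where "rep X = (SOME v. v \<in> X)" for X :: "complex set"
  have rep: "rep ((+) v ` M) - v \<in> M" for v
  proof -
    have "v \<in> (+) v ` M" using M.zero by force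
    then have "rep ((+) v ` M) \<in> (+) v ` M" unfolding rep_def by (rule someI)
    then show ?thesis by auto
  qed
  define sh where "sh X = (+) x ` X" for X
  have sh: "sh ((+) v ` M) = (+) (x + v) ` M" for v
    by (simp add: sh_def image_image add.assoc)
  have inj: "inj_on sh C"
    unfolding sh_def by (intro inj_onI) (simp add: inj_image_eq_iff)
  have "sh ` C \<subseteq> C"
  proof
    fix Y assume "Y \<in> sh ` C"
    then obtain v where "v \<in> L" "Y = sh ((+) v ` M)" by (auto simp: C_def)
    then show "Y \<in> C" unfolding sh C_def using L.add[OF assms(3)] by blast
  qed
  then have "sh ` C = C" using endo_inj_surj[OF fin _ inj] by blast
  then have perm: "(\<Sum>X\<in>C. rep (sh X)) = (\<Sum>X\<in>C. rep X)"
    using sum.reindex[OF inj, of rep] by simp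
  have "x + rep X - rep (sh X) \<in> M" if "X \<in> C" for X
  proof -
    obtain v where X: "X = (+) v ` M" using \<open>X \<in> C\<close> unfolding C_def by blast
    have "(rep X - v) - (rep (sh X) - (x + v)) \<in> M"
      unfolding X sh by (intro M.diff rep)
    then show ?thesis by (simp add: algebra_simps)
  qed
  \<comment> \<open>In the sum the representatives cancel by \<open>perm\<close>, and
    \<open>card C = l\<close> copies of \<open>x\<close> remain.\<close>
  then have "(\<Sum>X\<in>C. x + rep X - rep (sh X)) \<in> M" by (rule M.sum)
  then show ?thesis by (simp add: sum.distrib sum_subtractf perm card)
qed

section \<open>Three pairs of shortest vectors force a hexagonal lattice\<close>

lemma unit_vector_Re_le_half:
  assumes "cmod f = 1" "cmod (f - 1) \<ge> 1" "cmod (f + 1) \<ge> 1"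
  shows "\<bar>Re f\<bar> \<le> 1 / 2" "\<bar>Im f\<bar> \<ge> sqrt 3 / 2"
proof -
  have 1: "(Re f)\<^sup>2 + (Im f)\<^sup>2 = 1" using assms(1) cmod_power2[of f] by simp
  \<comment> \<open>The squared lengths of \<open>f - 1\<close> and \<open>f + 1\<close> are
    \<open>2 - 2 Re f\<close> and \<open>2 + 2 Re f\<close>.\<close>
  have "1 \<le> (cmod (f - 1))\<^sup>2" "1 \<le> (cmod (f + 1))\<^sup>2" using assms(2,3) by simp_all
  then have "1 \<le> (Re f - 1)\<^sup>2 + (Im f)\<^sup>2" "1 \<le> (Re f + 1)\<^sup>2 + (Im f)\<^sup>2"
    by (simp_all add: cmod_power2)
  then show Re: "\<bar>Re f\<bar> \<le> 1 / 2" using 1 by (simp add: power2_eq_square algebra_simps abs_le_iff)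
  have "\<bar>Re f\<bar>\<^sup>2 \<le> (1 / 2)\<^sup>2" using Re by (intro power_mono) auto
  then have "(sqrt 3 / 2)\<^sup>2 \<le> \<bar>Im f\<bar>\<^sup>2" using 1 by (simp add: power_divide)
  then show "\<bar>Im f\<bar> \<ge> sqrt 3 / 2" by (rule power2_le_imp_le) simp
qed

text \<open>Both vectors lie on the arc of the unit circle from 60 to 120 degrees and are at least
  60 degrees apart. So they are its two end points, one of which is \<open>omega\<close>.\<close>

lemma omega_of_two_unit_vectors:
  assumes "\<bar>Re f\<bar> \<le> 1 / 2" "Im f \<ge> sqrt 3 / 2" "\<bar>Re g\<bar> \<le> 1 / 2" "Im g \<ge> sqrt 3 / 2"
    and "cmod f = 1" "cmod g = 1" "cmod (f - g) \<ge> 1"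
  shows "f = omega \<or> g = omega"
proof -
  have f: "(Re f)\<^sup>2 + (Im f)\<^sup>2 = 1" and g: "(Re g)\<^sup>2 + (Im g)\<^sup>2 = 1"
    using assms(5,6) cmod_power2[of f] cmod_power2[of g] by simp_all
  have "1 \<le> (cmod (f - g))\<^sup>2" using assms(7) by simp
  then have "1 \<le> (Re f - Re g)\<^sup>2 + (Im f - Im g)\<^sup>2" by (simp add: cmod_power2)
  then have le: "Re f * Re g + Im f * Im g \<le> 1 / 2"
    using f g by (simp add: power2_eq_square algebra_simps)
  have pos: "0 < sqrt 3 / (2 :: real)" by simp
  \<comment> \<open>The imaginary parts have product at least 3/4, which pushes
    \<open>Re f * Re g\<close> down to its extreme value -1/4.\<close>
  have "(sqrt 3 / 2) * (sqrt 3 / 2) \<le> Im f * Im g"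
  proof (rule mult_mono)
    show "0 \<le> Im f" using pos assms(2) by linarith
  qed (use assms in auto)
  then have "Re f * Re g \<le> - 1 / 4" using le by simp
  then have prod: "1 / 4 \<le> \<bar>Re f\<bar> * \<bar>Re g\<bar>" by (simp add: abs_mult[symmetric])
  have "\<bar>Re f\<bar> * \<bar>Re g\<bar> \<le> \<bar>Re f\<bar> * (1 / 2)" using assms(3) by (intro mult_left_mono) auto
  then have rf: "\<bar>Re f\<bar> = 1 / 2" using prod assms(1) by linarith
  have "\<bar>Re f\<bar> * \<bar>Re g\<bar> \<le> (1 / 2) * \<bar>Re g\<bar>" using assms(1) by (intro mult_right_mono) auto
  then have rg: "\<bar>Re g\<bar> = 1 / 2" using prod assms(3) by linarith
  have Im: "Im h = sqrt 3 / 2"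
    if "\<bar>Re h\<bar> = 1 / 2" "(Re h)\<^sup>2 + (Im h)\<^sup>2 = 1" "Im h \<ge> sqrt 3 / 2" for h
  proof -
    have "(Re h)\<^sup>2 = (1 / 2)\<^sup>2" using that(1) by (metis power2_abs)
    then have "(Im h)\<^sup>2 = (sqrt 3 / 2)\<^sup>2" using that(2) by (simp add: power_divide)
    moreover have "Im h \<ge> 0" using that(3) pos by linarith
    ultimately show ?thesis by (rule power2_eq_imp_eq) simp
  qed
  have "Re f = - 1 / 2 \<or> Re g = - 1 / 2"
  proof (rule ccontr)
    assume "\<not> (Re f = - 1 / 2 \<or> Re g = - 1 / 2)"
    then have "Re f = 1 / 2" "Re g = 1 / 2" using rf rg by linarith+
    then have "Re f * Re g = 1 / 2 * (1 / 2)" by (simp only:)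
    then show False using \<open>Re f * Re g \<le> - 1 / 4\<close> by linarith
  qed
  then show ?thesis
    using Im[OF rf f assms(2)] Im[OF rg g assms(4)]
    by (auto simp: complex_eq_iff Re_omega Im_omega)
qed

text \<open>Rounding the coordinate along \<open>omega\<close> first and the real part next leaves
  errors of at most \<open>sqrt 3 / 4\<close> and 1/2, and 3/16 + 1/4 < 1.\<close>

lemma near_eisenstein_integer:
  obtains a b where "cmod (w - eis a b) < 1"
proof -
  define b where "b = round (Im w * 2 / sqrt 3)"
  define a where "a = round (Re w + of_int b / 2)"
  have "\<bar>of_int b - Im w * 2 / sqrt 3\<bar> \<le> 1 / 2" unfolding b_def by (rule of_int_round_abs_le)
  then have "\<bar>of_int b - Im w * 2 / sqrt 3\<bar> * (sqrt 3 / 2) \<le> 1 / 2 * (sqrt 3 / 2)"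
    by (intro mult_right_mono) auto
  also have "\<bar>of_int b - Im w * 2 / sqrt 3\<bar> * (sqrt 3 / 2) =
      \<bar>(of_int b - Im w * 2 / sqrt 3) * (sqrt 3 / 2)\<bar>" by (simp only: abs_mult) simp
  also have "(of_int b - Im w * 2 / sqrt 3) * (sqrt 3 / 2) = - Im (w - eis a b)"
    by (simp add: Im_eis field_simps)
  finally have "\<bar>Im (w - eis a b)\<bar> \<le> sqrt 3 / 4" unfolding abs_minus_cancel by simp
  then have "\<bar>Im (w - eis a b)\<bar>\<^sup>2 \<le> (sqrt 3 / 4)\<^sup>2" by (intro power_mono) auto
  moreover have "\<bar>Re (w - eis a b)\<bar> \<le> 1 / 2"
    using of_int_round_abs_le[of "Re w + of_int b / 2"] unfolding a_def minus_complex.sel Re_eis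
    by linarith
  then have "\<bar>Re (w - eis a b)\<bar>\<^sup>2 \<le> (1 / 2)\<^sup>2" by (intro power_mono) auto
  ultimately have "(cmod (w - eis a b))\<^sup>2 < 1" unfolding cmod_power2
    by (simp add: power_divide)
  then have "cmod (w - eis a b) < 1" by (simp add: power_less_one_iff)
  then show ?thesis by (rule that)
qed

text \<open>Divide by one short vector \<open>x\<close>. The other two, up to sign, fall on the arc
  of \<open>omega_of_two_unit_vectors\<close>, so \<open>x omega\<close> is in \<open>L\<close> and
  \<open>L\<close> contains all Eisenstein multiples of \<open>x\<close>. Any \<open>v\<close> in
  \<open>L\<close> is at distance less than 1 from such a multiple, and therefore equals it.\<close>

lemma (in subgroup_of_plane) hexagonal:
  assumes long: "\<And>v. v \<in> L \<Longrightarrow> v \<noteq> 0 \<Longrightarrow> cmod v \<ge> 1"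
    and S: "S \<subseteq> L" "\<And>v. v \<in> S \<Longrightarrow> cmod v = 1" "consists_of_pairs S 3"
  obtains e where "cmod e = 1" "L = {e * eis a b | a b. True}"
proof -
  have "card ((\<lambda>v. {v, - v}) ` S) = 3" using S(3) by (simp add: consists_of_pairs_def)
  then obtain X Y Z where XYZ: "(\<lambda>v. {v, - v}) ` S = {X, Y, Z}" "X \<noteq> Y" "Y \<noteq> Z" "X \<noteq> Z"
    unfolding card_3_iff by blast
  then have "X \<in> (\<lambda>v. {v, - v}) ` S" "Y \<in> (\<lambda>v. {v, - v}) ` S" "Z \<in> (\<lambda>v. {v, - v}) ` S" by simp_all
  then obtain x y z where xyz: "x \<in> S" "X = {x, - x}" "y \<in> S" "Y = {y, - y}" "z \<in> S" "Z = {z, - z}"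
    by blast
  then have ne: "x \<noteq> y" "x \<noteq> - y" "x \<noteq> z" "x \<noteq> - z" "y \<noteq> z" "y \<noteq> - z"
    using XYZ(2-4) by auto
  have x: "cmod x = 1" "x \<in> L" using xyz(1) S(1,2) by auto
  then have x0: "x \<noteq> 0" by auto
  have half: "\<exists>f. cmod f = 1 \<and> (x * f = v \<or> x * f = - v) \<and> \<bar>Re f\<bar> \<le> 1 / 2 \<and> Im f \<ge> sqrt 3 / 2"
    if v: "v \<in> S" "x \<noteq> v" "x \<noteq> - v" for v
  proof -
    \<comment> \<open>The sign is chosen so that \<open>f\<close> lies in the upper half
      plane.\<close>
    define f where "f = (if Im (v / x) \<ge> 0 then v / x else - (v / x))"
    have "cmod f = 1" using S(2)[OF v(1)] x by (simp add: f_def norm_divide)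
    have xf: "x * f = v \<or> x * f = - v" using x0 by (simp add: f_def)
    then have "x * (f - 1) \<in> L" "x * (f + 1) \<in> L"
      using v(1) S(1) x by (auto simp: algebra_simps intro!: diff add uminus)
    moreover have "f \<noteq> 1" "f \<noteq> - 1" using xf v(2,3) by auto
    then have "f - 1 \<noteq> 0" "f + 1 \<noteq> 0" by (simp_all add: eq_neg_iff_add_eq_0)
    ultimately have "1 \<le> cmod (x * (f - 1))" "1 \<le> cmod (x * (f + 1))"
      using x0 by (auto intro!: long)
    then have "cmod (f - 1) \<ge> 1" "cmod (f + 1) \<ge> 1" using x(1) by (simp_all add: norm_mult)
    from unit_vector_Re_le_half[OF \<open>cmod f = 1\<close> this]
    have "\<bar>Re f\<bar> \<le> 1 / 2" "\<bar>Im f\<bar> \<ge> sqrt 3 / 2" .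
    moreover have "Im f \<ge> 0" by (simp add: f_def)
    ultimately show ?thesis using \<open>cmod f = 1\<close> xf by auto
  qed
  obtain f where f: "cmod f = 1" "x * f = y \<or> x * f = - y" "\<bar>Re f\<bar> \<le> 1 / 2" "Im f \<ge> sqrt 3 / 2"
    using half[OF xyz(3) ne(1,2)] by blast
  obtain g where g: "cmod g = 1" "x * g = z \<or> x * g = - z" "\<bar>Re g\<bar> \<le> 1 / 2" "Im g \<ge> sqrt 3 / 2"
    using half[OF xyz(5) ne(3,4)] by blast
  have fgL: "x * f \<in> L" "x * g \<in> L" using f(2) g(2) xyz S(1) uminus by auto
  have "x * f \<noteq> x * g" using f(2) g(2) ne(5,6) by auto
  then have "1 \<le> cmod (x * f - x * g)" using fgL by (intro long diff) auto
  then have "1 \<le> cmod (f - g)" using x(1) by (simp add: right_diff_distrib[symmetric] norm_mult)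
  then have "f = omega \<or> g = omega" by (intro omega_of_two_unit_vectors f g)
  then have omega: "x * omega \<in> L" using fgL by blast
  have sub: "x * eis a b \<in> L" for a b
    using add[OF int_mult[OF x(2), of a] int_mult[OF omega, of b]]
    by (simp add: eis_def algebra_simps)
  have "\<exists>a b. v = x * eis a b" if "v \<in> L" for v
  proof -
    obtain a b where "cmod (v / x - eis a b) < 1" by (rule near_eisenstein_integer)
    moreover have "v - x * eis a b = x * (v / x - eis a b)" using x0 by (simp add: field_simps)
    ultimately have "cmod (v - x * eis a b) < 1" using x(1) by (simp add: norm_mult)
    then have "v - x * eis a b = 0" using long diff[OF that sub] by (meson not_le)
    then show ?thesis by auto
  qed
  then have "L = {x * eis a b | a b. True}" using sub by blast
  with x(1) show ?thesis by (rule that)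
qed

text \<open>After rescaling, \<open>L'\<close> is a rotation of the Eisenstein integers and
  \<open>S'\<close> is one pair given by \<open>a + b omega\<close>. Since \<open>M'\<close>
  contains this vector and \<open>l L'\<close>, it contains all the second vectors, so these are
  longer.\<close>

lemma form_imp_minimal_vector:
  assumes "prime l" and form: "s_and_s'_form_with_temperament 3 1 l L M \<tau>" and "\<tau>\<^sup>2 \<le> real l"
  obtains a b where "minimal_vector l a b" "enorm a b < int l" "\<tau>\<^sup>2 = of_int (enorm a b)"
proof -
  have l: "l > 0" using prime_gt_0_nat[OF assms(1)] .
  obtain S S' u where data: "tempered_perfect_data l L M S S' u"
    and S3: "consists_of_pairs S 3" and S1: "consists_of_pairs S' 1" and \<tau>: "\<tau> = sqrt u"
    using form unfolding s_and_s'_form_with_temperament_def by blast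
  obtain c where L: "is_lattice L" and M: "is_sublattice_of_index l M L"
    and c: "c > 0" and
    norm: "normalized_tempered_perfect
        ((\<lambda>v. of_real c * v) ` L) ((\<lambda>v. of_real c * v) ` M) S S' u"
    using data unfolding tempered_perfect_data_def by blast
  define L' where "L' = (\<lambda>v. of_real c * v) ` L"
  define M' where "M' = (\<lambda>v. of_real c * v) ` M"
  have SS: "S \<subseteq> L' - M'" "S' \<noteq> {}" "S' \<subseteq> M' - {0}"
    and cond: "tempered_conditions L' M' S S' (\<lambda>v. inner v v) u"
    using norm unfolding normalized_tempered_perfect_def L'_def M'_def by blast+
  note cond = cond[unfolded tempered_conditions_def]
  have u: "u \<ge> 1" using cond by (elim conjE)
  have AS: "\<forall>v\<in>S. inner v v = 1" using cond by (elim conjE)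
  have AL: "\<forall>v\<in>L' - M'. v \<notin> S \<longrightarrow> inner v v > 1" using cond by (elim conjE)
  have AS': "\<forall>v\<in>S'. inner v v = u" using cond by (elim conjE)
  have AM: "\<forall>v\<in>M' - {0}. v \<notin> S' \<longrightarrow> inner v v > u" using cond by (elim conjE)
  have M_lat: "is_lattice M" "M \<subseteq> L" using M unfolding is_sublattice_of_index_def by blast+
  have scale: "subgroup_of_plane ((\<lambda>v. of_real c * v) ` K)" if K: "is_lattice K" for K
  proof
    show "0 \<in> (\<lambda>v. of_real c * v) ` K" using lattice_zero[OF K] by force
    fix v w assume "v \<in> (\<lambda>v. of_real c * v) ` K" "w \<in> (\<lambda>v. of_real c * v) ` K"
    then obtain v' w' where vw: "v' \<in> K" "w' \<in> K" "v = of_real c * v'" "w = of_real c * w'" by blast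
    then have "v - w = of_real c * (v' - w')" by (simp add: right_diff_distrib)
    then show "v - w \<in> (\<lambda>v. of_real c * v) ` K" using lattice_diff[OF K vw(1,2)] by blast
  qed
  interpret L': subgroup_of_plane L' unfolding L'_def by (rule scale[OF L])
  interpret M': subgroup_of_plane M' unfolding M'_def by (rule scale[OF M_lat(1)])
  have lM: "of_nat l * v \<in> M'" if "v \<in> L'" for v
  proof -
    obtain w where "w \<in> L" "v = of_real c * w" using \<open>v \<in> L'\<close> by (auto simp: L'_def)
    then have "of_nat l * w \<in> M" "of_nat l * v = of_real c * (of_nat l * w)"
      using index_mult_mem_sublattice[OF L M] by auto
    then show ?thesis unfolding M'_def by blast
  qed
  have M'L': "M' \<subseteq> L'" using M_lat(2) by (auto simp: L'_def M'_def)
  have long: "cmod v \<ge> 1" if "v \<in> L'" "v \<noteq> 0" for v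
  proof -
    have "inner v v \<ge> 1"
    proof (cases "v \<in> M'")
      case True
      then show ?thesis using AS' AM u that(2) by (cases "v \<in> S'") auto
    next
      case False
      then show ?thesis using AS AL that(1) by (cases "v \<in> S") auto
    qed
    then show ?thesis using power2_le_imp_le[of 1 "cmod v"] by (simp add: dot_square_norm)
  qed
  have "S \<subseteq> L'" "\<And>v. v \<in> S \<Longrightarrow> cmod v = 1" using SS(1) AS by (auto simp: norm_eq_1)
  then obtain e where e: "cmod e = 1" "L' = {e * eis a b | a b. True}"
    using L'.hexagonal[OF long _ _ S3] by blast
  have e0: "e \<noteq> 0" using e(1) by auto
  have norm_e: "inner (e * eis a b) (e * eis a b) = of_int (enorm a b)" for a b
    by (simp add: dot_square_norm norm_mult e(1) cmod_eis_square)
  obtain v where v: "v \<in> S'" using SS(2) by blast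
  have S'v: "w = v \<or> w = - v" if "w \<in> S'" for w
  proof -
    have "card ((\<lambda>v. {v, - v}) ` S') = 1" using S1 by (simp add: consists_of_pairs_def)
    then obtain X where X: "(\<lambda>v. {v, - v}) ` S' = {X}" by (rule card_1_singletonE)
    have "{w, - w} \<in> {X}" "{v, - v} \<in> {X}" unfolding X[symmetric] using v that by blast+
    then have "{w, - w} = {v, - v}" by simp
    then show ?thesis by blast
  qed
  obtain a b where ab: "v = e * eis a b" using v SS(3) M'L' e(2) by blast
  have "inner v v = u" using AS' v by blast
  then have uN: "u = of_int (enorm a b)" unfolding ab norm_e by simp
  have ab_M': "e * eis a b \<in> M'" using v SS(3) ab by blast
  have min: "enorm a b < enorm x y"
    if "e * eis x y \<in> M'" "\<not> (x = 0 \<and> y = 0)" "\<not> (x = a \<and> y = b)" "\<not> (x = - a \<and> y = - b)" for x y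
  proof -
    have "e * eis x y \<noteq> 0" using e0 that(2) by (simp add: eis_eq_0_iff)
    moreover have "e * eis x y \<notin> S'"
    proof
      assume "e * eis x y \<in> S'"
      then have "e * eis x y = e * eis a b \<or> e * eis x y = e * eis (- a) (- b)"
        unfolding eis_minus[symmetric] mult_minus_right ab[symmetric] by (rule S'v)
      then show False using e0 that(3,4) by (simp add: eis_inj)
    qed
    ultimately have "inner (e * eis x y) (e * eis x y) > u" using AM that(1) by blast
    then show ?thesis by (simp add: norm_e uN)
  qed
  have \<tau>2: "\<tau>\<^sup>2 = of_int (enorm a b)" using \<tau> u uN by simp
  then have le: "enorm a b \<le> int l" using assms(3) by linarith
  have pos: "enorm a b > 0" using u uN by simp
  have cop: "coprime a b"
  proof (rule coprime_of_small_enorm[OF assms(1) le _ pos])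
    define g where "g = gcd a b"
    obtain a' b' where g: "a = g * a'" "b = g * b'" unfolding g_def by (metis dvdE gcd_dvd1 gcd_dvd2)
    have ne: "\<not> (a' = 0 \<and> b' = 0)" using pos g by (auto simp: enorm_def)
    have g0: "g > 0" unfolding g_def using pos by (auto simp: enorm_def)
    show "gcd a b dvd int l"
    proof (rule ccontr)
      assume "\<not> gcd a b dvd int l"
      then have "\<not> g dvd int l" by (simp add: g_def)
      then have "g \<noteq> 1" by auto
      \<comment> \<open>Were \<open>l\<close> to divide the gcd \<open>g\<close>, the norm would be
        at least \<open>l^2\<close>. So \<open>g\<close> is coprime to \<open>l\<close>, and a
        Bezout relation between \<open>l v / g\<close> and \<open>v\<close>, both in
        \<open>M'\<close>, puts the shorter vector \<open>v / g\<close> into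
        \<open>M'\<close>.\<close>
      have "\<not> int l dvd g"
      proof
        assume "int l dvd g"
        then obtain k where "g = int l * k" by blast
        then have eq: "enorm a b = (int l)\<^sup>2 * enorm (k * a') (k * b')"
          unfolding g by (simp add: mult.assoc enorm_mult)
        then have "enorm (k * a') (k * b') > 0" using pos by (simp add: zero_less_mult_iff)
        then have "(int l)\<^sup>2 * 1 \<le> enorm a b" unfolding eq by (intro mult_left_mono) auto
        then show False using le prime_square_not_le[OF assms(1)] by linarith
      qed
      then have "coprime (int l) g" using assms(1) by (simp add: prime_imp_coprime)
      then obtain r s where rs: "r * int l + s * g = 1"
        by (metis bezout_int coprime_iff_gcd_eq_1)
      have "e * eis a' b' \<in> L'" using e(2) by blast
      then have "of_int r * (of_nat l * (e * eis a' b')) + of_int s * (e * eis a b) \<in> M'"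
        using lM ab_M' by (intro M'.add M'.int_mult)
      also have "of_int r * (of_nat l * (e * eis a' b')) + of_int s * (e * eis a b) =
          of_int (r * int l + s * g) * (e * eis a' b')"
        unfolding g eis_scale[symmetric] by (simp add: algebra_simps)
      finally have "e * eis a' b' \<in> M'" using rs by simp
      have "1 < g\<^sup>2" using g0 \<open>g \<noteq> 1\<close> by (intro one_less_power) auto
      then have "1 * enorm a' b' < g\<^sup>2 * enorm a' b'"
        using enorm_pos[OF ne] by (rule mult_strict_right_mono)
      then have less: "enorm a' b' < enorm a b" by (simp add: g enorm_mult)
      then have "\<not> (a' = a \<and> b' = b)" "\<not> (a' = - a \<and> b' = - b)"
        by (auto simp: enorm_minus)
      with less show False using min[OF \<open>e * eis a' b' \<in> M'\<close> ne] by linarith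
    qed
  qed
  have sv_min: "enorm a b < enorm p q" if sv: "second_vector l a b p q" for p q
  proof (rule min)
    obtain c d t where "eis p q = of_nat l * eis c d + of_int t * eis a b"
      using sv unfolding second_vector_def by blast
    then have "e * eis p q = of_nat l * (e * eis c d) + of_int t * (e * eis a b)"
      by (simp add: algebra_simps)
    moreover have "e * eis c d \<in> L'" using e(2) by blast
    ultimately show "e * eis p q \<in> M'" using lM ab_M' M'.add M'.int_mult by metis
    have "a * q - b * p = int l" using sv l by (simp add: second_vector_iff)
    then show "\<not> (p = 0 \<and> q = 0)" "\<not> (p = a \<and> q = b)" "\<not> (p = - a \<and> q = - b)" using l by auto
  qed
  then have minimal: "minimal_vector l a b" using cop by (simp add: minimal_vector_def)
  \<comment> \<open>The end point \<open>l\<close> is not attained: \<open>N v < N w\<close> and a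
    pairing of at most \<open>N v\<close> turn the Gram identity into
    \<open>4 (N v)^2 < (N v)^2 + 3 l^2\<close>.\<close>
  have "enorm a b < int l"
  proof -
    obtain p q where sv: "second_vector l a b p q" using second_vector_exists[OF l cop] by blast
    have "4 * enorm a b * enorm a b < 4 * enorm a b * enorm p q"
      using sv_min[OF sv] pos by (intro mult_strict_left_mono) auto
    moreover have "\<bar>epair a b p q\<bar>\<^sup>2 \<le> (enorm a b)\<^sup>2"
      using sv l by (intro power_mono) (auto simp: second_vector_iff)
    ultimately have "3 * (enorm a b)\<^sup>2 < 3 * (int l)\<^sup>2"
      using second_vector_gram[OF l sv] by (simp add: power2_eq_square)
    then have "(enorm a b)\<^sup>2 < (int l)\<^sup>2" by simp
    then show ?thesis by (rule power2_less_imp_less) simp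
  qed
  then show ?thesis using that minimal \<tau>2 by blast
qed

section \<open>From minimal vectors to forms\<close>

text \<open>\<open>Im (cnj x * y)\<close> is the real determinant of \<open>x\<close> and
  \<open>y\<close>; the coefficients for the span come from Cramer's rule.\<close>

lemma is_latticeI:
  assumes "Im (cnj x * y) \<noteq> 0"
  shows "is_lattice {of_int m * x + of_int n * y | m n. True}"
proof -
  have D: "Re x * Im y - Im x * Re y \<noteq> 0" using assms by simp
  have y0: "y \<noteq> 0" using D by auto
  have "x \<noteq> k *\<^sub>R y" for k using D by auto
  then have nspan: "x \<notin> span {y}" unfolding span_singleton by blast
  have "x \<noteq> y" using nspan span_base[of y "{y}"] by auto
  moreover have "independent {x, y}"
    using nspan y0 \<open>x \<noteq> y\<close> by (simp add: independent_insert)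
  moreover have "span {x, y} = UNIV"
  proof -
    have "z \<in> span {x, y}" for z
    proof -
      define s where "s = (Re z * Im y - Im z * Re y) / (Re x * Im y - Im x * Re y)"
      define t where "t = (Re x * Im z - Im x * Re z) / (Re x * Im y - Im x * Re y)"
      have "z = s *\<^sub>R x + t *\<^sub>R y"
        using D unfolding complex_eq_iff s_def t_def by (simp add: divide_simps) algebra
      then show ?thesis
        by (simp add: span_add span_base span_scale)
    qed
    then show ?thesis by blast
  qed
  ultimately show ?thesis unfolding is_lattice_def by blast
qed

lemma is_lattice_range_eis: "is_lattice {eis m n | m n. True}"
proof -
  have "{eis m n | m n. True} = {of_int m * 1 + of_int n * omega | m n. True}" by (simp add: eis_def)
  then show ?thesis using is_latticeI[of 1 omega] by (simp add: Im_omega)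
qed

text \<open>For primitive \<open>a + b \<omega>\<close> this is the sublattice of index \<open>l\<close> containing it.\<close>

definition index_sublattice :: "nat \<Rightarrow> int \<Rightarrow> int \<Rightarrow> complex set" where
  "index_sublattice l a b = {eis x y | x y. int l dvd a * y - b * x}"

lemma eis_in_index_sublattice_iff: "eis x y \<in> index_sublattice l a b \<longleftrightarrow> int l dvd a * y - b * x"
  unfolding index_sublattice_def by (auto simp: eis_inj)

text \<open>If \<open>a y - b x = l n\<close>, subtracting \<open>n (p + q omega)\<close> leaves a
  vector parallel to the primitive \<open>a + b omega\<close>, hence a multiple of it.\<close>

lemma index_sublattice_eq:
  assumes "coprime a b" "a * q - b * p = int l"
  shows "index_sublattice l a b = {of_int m * eis a b + of_int n * eis p q | m n. True}"
proof (intro set_eqI iffI)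
  fix v assume "v \<in> index_sublattice l a b"
  then obtain x y n where v: "v = eis x y" "a * y - b * x = int l * n"
    unfolding index_sublattice_def by blast
  have "a * (y - n * q) = b * (x - n * p)"
    using v(2) assms(2)[symmetric] by (simp add: algebra_simps)
  then obtain m where "x - n * p = m * a" "y - n * q = m * b"
    using assms(1) by (auto elim: multiple_of_coprime_pair)
  then have "x = m * a + n * p" "y = m * b + n * q" by simp_all
  then have "v = of_int m * eis a b + of_int n * eis p q"
    unfolding v(1) eis_scale eis_add by simp
  then show "v \<in> {of_int m * eis a b + of_int n * eis p q | m n. True}" by blast
next
  fix v assume "v \<in> {of_int m * eis a b + of_int n * eis p q | m n. True}"
  then obtain m n where "v = eis (m * a + n * p) (m * b + n * q)"
    by (auto simp: eis_scale eis_add)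
  moreover have "a * (m * b + n * q) - b * (m * a + n * p) = int l * n"
    unfolding assms(2)[symmetric] by (simp add: algebra_simps)
  ultimately show "v \<in> index_sublattice l a b" by (simp add: eis_in_index_sublattice_iff)
qed

lemma is_lattice_index_sublattice:
  assumes "l > 0" "coprime a b"
  shows "is_lattice (index_sublattice l a b)"
proof -
  obtain p q where sv: "second_vector l a b p q" using second_vector_exists[OF assms] by blast
  then have det: "a * q - b * p = int l" using assms(1) by (simp add: second_vector_iff)
  have "Im (cnj (eis a b) * eis p q) = of_int (a * q - b * p) * (sqrt 3 / 2)"
    by (simp add: Re_eis Im_eis field_simps)
  also have "\<dots> \<noteq> 0" unfolding det using assms(1) by simp
  finally have "Im (cnj (eis a b) * eis p q) \<noteq> 0" .
  then show ?thesis unfolding index_sublattice_eq[OF assms(2) det] by (rule is_latticeI)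
qed

text \<open>The functional \<open>a y - b x\<close> sends \<open>c + d omega\<close> to 1, and the
  sublattice is the preimage of the multiples of \<open>l\<close>. So the multiples of
  \<open>c + d omega\<close> by \<open>0\<close>, ..., \<open>l - 1\<close> represent the
  cosets.\<close>

lemma index_of_index_sublattice:
  assumes "l > 0" "coprime a b"
  shows "is_sublattice_of_index l (index_sublattice l a b) {eis m n | m n. True}"
proof -
  let ?M = "index_sublattice l a b"
  have lat: "is_lattice ?M" using assms by (rule is_lattice_index_sublattice)
  interpret subgroup_of_plane ?M using lat by (rule subgroup_of_lattice)
  obtain x y where "x * a + y * b = 1" using assms(2)
    by (metis bezout_int coprime_iff_gcd_eq_1)
  define c d where "c = - y" and "d = x"
  have cd: "a * d - b * c = 1"
    using \<open>x * a + y * b = 1\<close> by (simp add: c_def d_def algebra_simps)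
  define g where "g r = (+) (eis (r * c) (r * d)) ` ?M" for r
  have rep: "(+) (eis x y) ` ?M = g r \<longleftrightarrow> int l dvd a * y - b * x - r" for x y r
  proof -
    have "(+) (eis x y) ` ?M = g r \<longleftrightarrow> int l dvd a * (y - r * d) - b * (x - r * c)"
      unfolding g_def coset_eq_iff eis_diff eis_in_index_sublattice_iff ..
    also have "a * (y - r * d) - b * (x - r * c) = a * y - b * x - r * (a * d - b * c)"
      by (simp add: algebra_simps)
    finally show ?thesis by (simp add: cd)
  qed
  have "(\<lambda>v. (+) v ` ?M) ` {eis m n | m n. True} = g ` {0..<int l}"
  proof (intro set_eqI iffI)
    fix X assume "X \<in> (\<lambda>v. (+) v ` ?M) ` {eis m n | m n. True}"
    then obtain x y where X: "X = (+) (eis x y) ` ?M" by blast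
    have "X = g ((a * y - b * x) mod int l)"
      unfolding X rep by (simp add: minus_mod_eq_mult_div)
    moreover have "(a * y - b * x) mod int l \<in> {0..<int l}" using assms(1) by simp
    ultimately show "X \<in> g ` {0..<int l}" by blast
  qed (auto simp: g_def)
  moreover have "inj_on g {0..<int l}"
  proof (rule inj_onI)
    fix r s assume rs: "r \<in> {0..<int l}" "s \<in> {0..<int l}" "g r = g s"
    then have "int l dvd a * (r * d) - b * (r * c) - s"
      using rep[of "r * c" "r * d" s] by (simp add: g_def)
    also have "a * (r * d) - b * (r * c) - s = r * (a * d - b * c) - s" by (simp add: algebra_simps)
    finally have "int l dvd r - s" by (simp add: cd)
    then have "r mod int l = s mod int l" by (simp add: mod_eq_dvd_iff)
    then show "r = s" using rs by simp
  qed
  moreover have "?M \<subseteq> {eis m n | m n. True}" unfolding index_sublattice_def by blast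
  ultimately show ?thesis
    unfolding is_sublattice_of_index_def using lat by (simp add: card_image)
qed

text \<open>Lagrange reduction: \<open>v\<close> and its second vector \<open>w\<close> form a
  reduced basis with \<open>N v < N w\<close>. For a combination \<open>m v + n w\<close> with
  \<open>n\<close> nonzero the norm exceeds \<open>(m^2 - |m n| + n^2) N v\<close>; for
  \<open>n = 0\<close> only the multiples by 1 and -1 are as short as \<open>v\<close>.\<close>

lemma minimal_vector_unique_minimum:
  assumes "l > 0" "minimal_vector l a b" "eis x y \<in> index_sublattice l a b" "eis x y \<noteq> 0"
    and "eis x y \<noteq> eis a b" "eis x y \<noteq> - eis a b"
  shows "enorm a b < enorm x y"
proof -
  have cop: "coprime a b" using assms(2) by (simp add: minimal_vector_def)
  obtain p q where sv: "second_vector l a b p q" using second_vector_exists[OF assms(1) cop] by blast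
  then have det: "a * q - b * p = int l" and small: "\<bar>epair a b p q\<bar> \<le> enorm a b"
    using assms(1) by (simp_all add: second_vector_iff)
  have less: "enorm a b < enorm p q" using assms(2) sv by (simp add: minimal_vector_def)
  have pos: "enorm a b > 0" using cop by (rule enorm_pos_coprime)
  obtain m n where "eis x y = of_int m * eis a b + of_int n * eis p q"
    using assms(3) unfolding index_sublattice_eq[OF cop det] by blast
  then have xy: "x = m * a + n * p" "y = m * b + n * q" by (simp_all add: eis_scale eis_add eis_inj)
  have N: "enorm x y = m\<^sup>2 * enorm a b + m * n * epair a b p q + n\<^sup>2 * enorm p q"
    unfolding xy by (rule enorm_combination)
  show ?thesis
  proof (cases "n = 0")
    case True
    then have "m \<noteq> 0" "m \<noteq> 1" "m \<noteq> - 1"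
      using assms(4-6) unfolding xy by (auto simp: eis_eq_0_iff eis_inj eis_minus)
    then have "1 < \<bar>m\<bar>" by linarith
    then have "1 < \<bar>m\<bar>\<^sup>2" by (intro one_less_power) auto
    then have "1 * enorm a b < m\<^sup>2 * enorm a b" using pos by (intro mult_strict_right_mono) auto
    then show ?thesis using N True by simp
  next
    case False
    \<comment> \<open>The coefficient \<open>m^2 - |m n| + n^2\<close> is itself an Eisenstein norm,
      hence a positive integer.\<close>
    have "enorm \<bar>m\<bar> \<bar>n\<bar> > 0" using False by (intro enorm_pos) auto
    then have "1 * enorm a b \<le> enorm \<bar>m\<bar> \<bar>n\<bar> * enorm a b" using pos by (intro mult_right_mono) auto
    also have "\<dots> = m\<^sup>2 * enorm a b - \<bar>m * n\<bar> * enorm a b + n\<^sup>2 * enorm a b"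
      by (simp add: enorm_def abs_mult algebra_simps)
    also have "\<dots> < m\<^sup>2 * enorm a b - \<bar>m * n\<bar> * enorm a b + n\<^sup>2 * enorm p q"
      using less False by simp
    also have "\<dots> \<le> m\<^sup>2 * enorm a b - \<bar>m * n\<bar> * \<bar>epair a b p q\<bar> + n\<^sup>2 * enorm p q"
      using mult_left_mono[OF small, of "\<bar>m * n\<bar>"] by simp
    also have "\<dots> \<le> enorm x y"
      unfolding N abs_mult[symmetric] using abs_ge_minus_self[of "m * n * epair a b p q"] by linarith
    finally show ?thesis by simp
  qed
qed

section \<open>The six units and the form they determine\<close>

definition eis_unit_pairs :: "(int \<times> int) set" where
  "eis_unit_pairs = {(1, 0), (- 1, 0), (0, 1), (0, - 1), (1, 1), (- 1, - 1)}"

text \<open>Completing the square in either variable confines both coordinates to -1, 0, 1. The pair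
  \<open>(1, 1)\<close> is the unit \<open>- omega^2 = 1 + omega\<close>.\<close>

lemma enorm_eq_1_iff: "enorm x y = 1 \<longleftrightarrow> (x, y) \<in> eis_unit_pairs"
proof
  assume 1: "enorm x y = 1"
  have "4 * enorm x y = (2 * y - x)\<^sup>2 + 3 * x\<^sup>2"
    by (simp add: enorm_def power2_eq_square algebra_simps)
  then have "x\<^sup>2 < 4" "y\<^sup>2 < 4"
    using 1 enorm_four[of x y] zero_le_power2[of "2 * x - y"] zero_le_power2[of "2 * y - x"]
    by linarith+
  then have "\<bar>x\<bar>\<^sup>2 < 2\<^sup>2" "\<bar>y\<bar>\<^sup>2 < 2\<^sup>2" by simp_all
  then have "\<bar>x\<bar> < 2" "\<bar>y\<bar> < 2" 
    using power2_less_imp_less[of "\<bar>x\<bar>" 2] power2_less_imp_less[of "\<bar>y\<bar>" 2] by simp_all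
  then have "x \<in> {- 1, 0, 1}" "y \<in> {- 1, 0, 1}" by auto
  then show "(x, y) \<in> eis_unit_pairs" using 1 by (auto simp: enorm_def eis_unit_pairs_def)
qed (auto simp: enorm_def eis_unit_pairs_def)

text \<open>A binary quadratic form has three coefficients. The values at \<open>1\<close> and
  \<open>omega\<close> give two of them, and the value at \<open>1 + omega\<close> gives the cross
  term by polarization. This yields the perfection condition.\<close>

lemma quadratic_form_determined:
  assumes "bilinear b" "\<And>x y. b x y = b y x" "b 1 1 = (1::real)" "b omega omega = 1"
    and "b (1 + omega) (1 + omega) = 1"
  shows "b z z = inner z z"
proof -
  note bil = bilinear_ladd[OF assms(1)] bilinear_radd[OF assms(1)]
    bilinear_lmul[OF assms(1)] bilinear_rmul[OF assms(1)]
  define s t where "s = Re z + Im z / sqrt 3" and "t = 2 * Im z / sqrt 3"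
  have z: "z = s *\<^sub>R 1 + t *\<^sub>R omega"
    by (simp add: complex_eq_iff Re_omega Im_omega s_def t_def)
  have cross: "2 * b 1 omega = - 1"
    using assms(3-5) assms(2)[of omega 1] by (simp add: bil)
  have "b z z = s\<^sup>2 + s * t * (2 * b 1 omega) + t\<^sup>2"
    unfolding z using assms(2)[of omega 1] assms(3,4)
    by (simp add: bil power2_eq_square algebra_simps)
  also have "\<dots> = s\<^sup>2 - s * t + t\<^sup>2" unfolding cross by simp
  also have "\<dots> = inner z z"
    by (simp add: inner_complex_def s_def t_def power2_eq_square field_simps)
  finally show ?thesis .
qed

lemma consists_of_pairs_units:
  "consists_of_pairs {eis x y | x y. (x, y) \<in> eis_unit_pairs} 3"
proof -
  let ?S = "{eis x y | x y. (x, y) \<in> eis_unit_pairs}"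
  have S: "?S = {eis 1 0, eis (- 1) 0, eis 0 1, eis 0 (- 1), eis 1 1, eis (- 1) (- 1)}"
    unfolding eis_unit_pairs_def by auto
  have "(\<lambda>v. {v, - v}) ` ?S =
      {{eis 1 0, eis (- 1) 0}, {eis 0 1, eis 0 (- 1)}, {eis 1 1, eis (- 1) (- 1)}}"
    unfolding S by (auto simp: eis_minus)
  moreover have "card \<dots> = 3" by (simp add: card_insert_if doubleton_eq_iff eis_inj)
  moreover have "uminus ` ?S = ?S" unfolding S by (auto simp: eis_minus)
  moreover have "finite ?S" unfolding S by simp
  ultimately show ?thesis unfolding consists_of_pairs_def by simp
qed

text \<open>The Eisenstein integers need no rescaling: \<open>S\<close> consists of the six units
  and \<open>S'\<close> of \<open>v\<close> and \<open>- v\<close>. The units fix the form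
  \<open>B\<close>, and then \<open>u'\<close> is its value at \<open>v\<close>.\<close>

lemma minimal_vector_imp_form:
  assumes "prime l" "minimal_vector l a b" "1 < enorm a b"
  shows "s_and_s'_form_with_temperament 3 1 l {eis m n | m n. True} (index_sublattice l a b)
    (sqrt (of_int (enorm a b)))"
proof -
  have l: "l > 0" using prime_gt_0_nat[OF assms(1)] .
  have cop: "coprime a b" using assms(2) by (simp add: minimal_vector_def)
  define L where "L = {eis m n | m n. True}"
  define M where "M = index_sublattice l a b"
  define S where "S = {eis x y | x y. (x, y) \<in> eis_unit_pairs}"
  define S' where "S' = {eis a b, - eis a b}"
  define u where "u = real_of_int (enorm a b)"
  have S: "eis x y \<in> S \<longleftrightarrow> enorm x y = 1" for x y
    unfolding S_def enorm_eq_1_iff by (auto simp: eis_inj)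
  have nz: "eis a b \<noteq> 0" using assms(3) by (auto simp: eis_eq_0_iff enorm_def)
  have S'M: "S' \<subseteq> M - {0}"
    using nz by (auto simp: S'_def M_def eis_minus eis_in_index_sublattice_iff eis_eq_0_iff)
  have M_min: "u < inner v v" if "v \<in> M - {0}" "v \<notin> S'" for v
  proof -
    obtain x y where v: "v = eis x y" using \<open>v \<in> M - {0}\<close> unfolding M_def index_sublattice_def by blast
    then show ?thesis
      using minimal_vector_unique_minimum[OF l assms(2), of x y] that
      by (simp add: inner_eis_self u_def M_def S'_def)
  qed
  have S'u: "inner v v = u" if "v \<in> S'" for v
    using that by (auto simp: S'_def inner_eis_self u_def)
  have u: "u > 1" using assms(3) by (simp add: u_def)
  have S1: "inner v v = 1" if "v \<in> S" for v
  proof -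
    obtain x y where "v = eis x y" using \<open>v \<in> S\<close> unfolding S_def by blast
    then show ?thesis using that S by (simp add: inner_eis_self)
  qed
  \<comment> \<open>Nonzero vectors of \<open>M\<close> have norm at least \<open>u > 1\<close>, so
    no unit lies in \<open>M\<close>.\<close>
  have SM: "v \<notin> M" if "v \<in> S" for v
  proof
    assume "v \<in> M"
    moreover have "inner v v = 1" using that by (rule S1)
    moreover have "v \<noteq> 0" using \<open>inner v v = 1\<close> by auto
    ultimately show False using M_min[of v] S'u[of v] u by (cases "v \<in> S'") auto
  qed
  have SL: "S \<subseteq> L - M" using SM unfolding S_def L_def by blast
  have units: "1 \<in> S" "omega \<in> S" "1 + omega \<in> S"
    using S[of 1 0] S[of 0 1] S[of 1 1] by (simp_all add: eis_def enorm_def)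
  have L_min: "inner v v > 1" if v: "v \<in> L - M" "v \<notin> S" for v
  proof -
    obtain x y where xy: "v = eis x y" using v(1) unfolding L_def by blast
    have "0 \<in> M" unfolding M_def using eis_in_index_sublattice_iff[of 0 0 l a b] by (simp add: eis_def)
    then have "\<not> (x = 0 \<and> y = 0)" using v(1) xy by (auto simp: eis_def)
    then have "enorm x y > 0" by (rule enorm_pos)
    moreover have "enorm x y \<noteq> 1" using S v(2) xy by blast
    ultimately show ?thesis using xy by (simp add: inner_eis_self)
  qed
  have cond: "tempered_conditions L M S S' (\<lambda>v. inner v v) u"
    unfolding tempered_conditions_def using S1 L_min S'u M_min u by auto
  have unique: "B = (\<lambda>v. inner v v) \<and> u' = u"
    if B: "pos_def_quadratic_form B" "tempered_conditions L M S S' B u'" for B u'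
  proof -
    obtain b' where b: "bilinear b'" "\<forall>x y. b' x y = b' y x" "\<forall>x. B x = b' x x"
      using B(1) unfolding pos_def_quadratic_form_def by blast
    have BS: "\<forall>v\<in>S. B v = 1" using B(2)[unfolded tempered_conditions_def] by (elim conjE)
    have BS': "\<forall>v\<in>S'. B v = u'" using B(2)[unfolded tempered_conditions_def] by (elim conjE)
    have "b' v v = 1" if "v \<in> S" for v using BS b(3) that by simp
    then have "b' z z = inner z z" for z
      using units b(2) by (intro quadratic_form_determined[OF b(1)]) auto
    then have "B = (\<lambda>v. inner v v)" using b(3) by auto
    moreover from this have "u' = u" using BS' S'u[of "eis a b"] by (simp add: S'_def)
    ultimately show ?thesis by simp
  qed
  have "normalized_tempered_perfect L M S S' u"
    unfolding normalized_tempered_perfect_def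
    using SL S'M cond unique units(1) by (auto simp: S'_def)
  then have "tempered_perfect_data l L M S S' u"
    unfolding tempered_perfect_data_def
    using is_lattice_range_eis index_of_index_sublattice[OF l cop]
    by (auto simp: L_def M_def intro!: exI[of _ 1])
  moreover have "consists_of_pairs S 3" unfolding S_def by (rule consists_of_pairs_units)
  moreover have "consists_of_pairs S' 1" 
    by (auto simp: consists_of_pairs_def S'_def insert_commute)
  ultimately show ?thesis
    unfolding s_and_s'_form_with_temperament_def L_def M_def u_def by blast
qed

theorem mainTheorem2:
  fixes l :: nat
  assumes "prime l"
  shows "alg_terminates l \<and>
    (\<forall>T. alg_output l T \<longrightarrow>
       real ` T = {\<tau>\<^sup>2 | \<tau>. 3 / 4 * real l \<le> \<tau>\<^sup>2 \<and> \<tau>\<^sup>2 \<le> real l \<and>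
                      (\<exists>L M. s_and_s'_form_with_temperament 3 1 l L M \<tau>)})"
proof (intro conjI allI impI)
  show "alg_terminates l" using assms by (rule alg_terminates)
  fix T assume "alg_output l T"
  then have T: "T = {k \<in> initial_norms l. \<exists>a b. minimal_vector l a b \<and> eis_norm a b = k}"
    by (rule alg_output_eq[OF assms])
  show "real ` T = {\<tau>\<^sup>2 | \<tau>. 3 / 4 * real l \<le> \<tau>\<^sup>2 \<and> \<tau>\<^sup>2 \<le> real l \<and>
                      (\<exists>L M. s_and_s'_form_with_temperament 3 1 l L M \<tau>)}" (is "_ = ?R")
  proof (intro set_eqI iffI)
    fix x assume "x \<in> real ` T"
    then obtain a b where ab: "minimal_vector l a b" "eis_norm a b \<in> initial_norms l"
      and x: "x = real (eis_norm a b)" unfolding T by blast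
    have "coprime a b" using ab(1) by (simp add: minimal_vector_def)
    then have range: "3 * int l \<le> 4 * enorm a b" "enorm a b < int l"
      using ab(2) by (simp_all add: eis_norm_in_initial_norms_iff)
    \<comment> \<open>\<open>l >= 2\<close> gives \<open>4 N v >= 6\<close>; this keeps the units
      out of the sublattice.\<close>
    have "1 < enorm a b" using range(1) prime_ge_2_nat[OF assms] by linarith
    then have form: "s_and_s'_form_with_temperament 3 1 l {eis m n | m n. True}
        (index_sublattice l a b) (sqrt (of_int (enorm a b)))"
      by (rule minimal_vector_imp_form[OF assms ab(1)])
    have "real (eis_norm a b) = of_int (enorm a b)"
      unfolding int_eis_norm[symmetric] by simp
    then have x': "x = (sqrt (of_int (enorm a b)))\<^sup>2" using x enorm_nonneg[of a b] by simp
    have "3 / 4 * real l \<le> of_int (enorm a b)" "of_int (enorm a b) \<le> real l"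
      using range by linarith+
    then have "3 / 4 * real l \<le> x" "x \<le> real l" using x' enorm_nonneg[of a b] by simp_all
    with x' form show "x \<in> ?R" by blast
  next
    fix x assume "x \<in> ?R"
    then obtain \<tau> L M where x: "x = \<tau>\<^sup>2" "3 / 4 * real l \<le> \<tau>\<^sup>2" "\<tau>\<^sup>2 \<le> real l"
      and form: "s_and_s'_form_with_temperament 3 1 l L M \<tau>" by blast
    obtain a b where ab: "minimal_vector l a b" "enorm a b < int l" "\<tau>\<^sup>2 = of_int (enorm a b)"
      using form_imp_minimal_vector[OF assms form x(3)] by blast
    have "real (3 * l) \<le> real_of_int (4 * enorm a b)" using x(2) ab(3) by simp
    then have "3 * int l \<le> 4 * enorm a b" by linarith
    then have "eis_norm a b \<in> T"
      using ab by (auto simp: T eis_norm_in_initial_norms_iff minimal_vector_def)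
    moreover have "x = real (eis_norm a b)"
      using x(1) ab(3) unfolding int_eis_norm[symmetric] by simp
    ultimately show "x \<in> real ` T" by blast
  qed
qed

end
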